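(* Let $\Phi=(\Phi_x)_{x\in V}$ be positive reals. For any starting point $z\in V$, the process $\check Y$ ends at $x_0$, i.e. $$S<\infty\quad\text{and}\quad \check Y_S=x_0,\qquad \mathbb{P}^{\check Y}_{\Phi,z}\text{-almost surely}.$$
   Context: $G=(V,E)$ is a finite connected undirected graph without loops, with positive conductances $(W_e)_{e\in E}$; $W_{x,y}=W_{\{x,y\}}$ if $\{x,y\}\in E$ and $W_{x,y}=0$ otherwise. A vertex $x_0\in V$ is fixed. The Ising model on $G$ with interaction $(J_{i,j})_{\{i,j\}\in E}$ and boundary condition $\sigma_{x_0}=+1$ is the probability on $\{\sigma\in\{-1,+1\}^V:\sigma_{x_0}=+1\}$ giving $\sigma$ a weight proportional to $\exp(\sum_{\{i,j\}\in E}J_{i,j}\sigma_i\sigma_j)$. For positive reals $\Phi=(\Phi_x)_{x\in V}$, $\mathbb{P}^{\check Y}_{\Phi,z}$ is the law of the continuous-time $V$-valued jump process $(\check Y_s)$ with $\check Y_0=z$ defined as follows. Put $\check L_i(s)=\Phi_i-\int_0^s 1_{\{\check Y_r=i\}}\,dr$, and let $\langle\cdot\rangle_s$ denote the expectation of the Ising model on $G$ with interaction $J_{i,j}(s)=W_{i,j}\check L_i(s)\check L_j(s)$ and boundary condition $\sigma_{x_0}=+1$. Conditionally on the past at time $s$, if $\check Y_s=i$, the process jumps from $i$ to $j$ at rate $W_{i,j}\check L_j(s)\,\langle\sigma_j\rangle_s/\langle\sigma_i\rangle_s$. It is stopped at time $S=\sup\{s\ge0:\check L_i(s)>0\text{ for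 all }i\in V\}$; one has $\langle\sigma_x\rangle_s>0$ for all $x\in V$ and $s<S$, so the process is defined up to time $S$. $\check Y_S$ denotes the vertex at which the process is stopped (the vertex occupied as $s\uparrow S$). *)

theory Defs
  imports "HOL-Probability.Probability"
begin

text \<open>A graph is given by its set of edges \<open>E\<close> on the finite vertex type \<open>'v\<close> (the vertex set is
  \<open>UNIV\<close>); an edge is an unordered pair \<open>{x, y}\<close> with \<open>x \<noteq> y\<close>. Conductances are functions of edges.\<close>

definition loopless :: "'v set set \<Rightarrow> bool" where
  "loopless E \<longleftrightarrow> (\<forall>e\<in>E. \<exists>x y. x \<noteq> y \<and> e = {x, y})"

definition connected_graph :: "'v set set \<Rightarrow> bool" where
  "connected_graph E \<longleftrightarrow> (\<forall>x y. (\<lambda>a b. {a, b} \<in> E)\<^sup>*\<^sup>* x y)"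

definition conductance :: "'v set set \<Rightarrow> ('v set \<Rightarrow> real) \<Rightarrow> 'v \<Rightarrow> 'v \<Rightarrow> real" where
  "conductance E W x y = (if {x, y} \<in> E then W {x, y} else 0)"


section \<open>The Ising model with plus boundary condition at one vertex\<close>

definition spins :: "'v \<Rightarrow> ('v \<Rightarrow> real) set" where
  "spins x0 = {\<sigma>. (\<forall>x. \<sigma> x \<in> {-1, 1}) \<and> \<sigma> x0 = 1}"

text \<open>For an edge \<open>e = {i, j}\<close> the product over \<open>e\<close> is \<open>\<sigma> i * \<sigma> j\<close>.\<close>

definition ising_weight :: "'v set set \<Rightarrow> ('v set \<Rightarrow> real) \<Rightarrow> ('v \<Rightarrow> real) \<Rightarrow> real" where
  "ising_weight E J \<sigma> = exp (\<Sum>e\<in>E. J e * (\<Prod>x\<in>e. \<sigma> x))"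

definition ising_expectation ::
  "'v set set \<Rightarrow> ('v set \<Rightarrow> real) \<Rightarrow> 'v \<Rightarrow> (('v \<Rightarrow> real) \<Rightarrow> real) \<Rightarrow> real" where
  "ising_expectation E J x0 f =
     (\<Sum>\<sigma>\<in>spins x0. f \<sigma> * ising_weight E J \<sigma>) / (\<Sum>\<sigma>\<in>spins x0. ising_weight E J \<sigma>)"

text \<open>\<open>magnetization E W x0 L i\<close> is the expectation of \<open>\<sigma> i\<close> for the interaction
  \<open>J\<^sub>x\<^sub>y = W\<^sub>x\<^sub>y L\<^sub>x L\<^sub>y\<close>.\<close>

definition magnetization ::
  "'v set set \<Rightarrow> ('v set \<Rightarrow> real) \<Rightarrow> 'v \<Rightarrow> ('v \<Rightarrow> real) \<Rightarrow> 'v \<Rightarrow> real" where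
  "magnetization E W x0 L i = ising_expectation E (\<lambda>e. W e * (\<Prod>x\<in>e. L x)) x0 (\<lambda>\<sigma>. \<sigma> i)"

definition jump_rate ::
  "'v set set \<Rightarrow> ('v set \<Rightarrow> real) \<Rightarrow> 'v \<Rightarrow> ('v \<Rightarrow> real) \<Rightarrow> 'v \<Rightarrow> 'v \<Rightarrow> real" where
  "jump_rate E W x0 L i j =
     conductance E W i j * L j * magnetization E W x0 L j / magnetization E W x0 L i"


section \<open>The jump process\<close>

text \<open>The process is the minimal jump process with the above rates, realised by competing
  exponential clocks: \<open>\<xi> n j\<close> are independent exponential variables of parameter 1, and during the
  stay after the \<open>n\<close>-th jump the clock of \<open>j\<close> rings as soon as the rate towards \<open>j\<close>, integrated
  since the beginning of that stay, reaches \<open>\<xi> n j\<close>. Hence, given the past, the process jumps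
  to \<open>j\<close> at the current value of the rate towards \<open>j\<close>.

  If a stay at \<open>i\<close> begins with remaining local times \<open>L\<close>, then after a duration \<open>v\<close> of this stay the
  remaining local times are \<open>L(i := L i - v)\<close>; only durations \<open>u < L i\<close> are allowed, and the ringing
  time is \<open>\<infinity>\<close> if the clock has not rung before \<open>L i\<close> is used up.\<close>

definition clocks :: "(nat \<Rightarrow> 'v \<Rightarrow> real) measure" where
  "clocks = (\<Pi>\<^sub>M n\<in>UNIV. \<Pi>\<^sub>M j\<in>UNIV. density lborel (exponential_density 1))"

definition ring_time ::
  "'v set set \<Rightarrow> ('v set \<Rightarrow> real) \<Rightarrow> 'v \<Rightarrow> ('v \<Rightarrow> real) \<Rightarrow> 'v \<Rightarrow> ('v \<Rightarrow> real) \<Rightarrow> 'v \<Rightarrow> ereal" where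
  "ring_time E W x0 L i c j =
     Inf {ereal u | u. 0 \<le> u \<and> u < L i \<and>
            c j \<le> integral {0..u} (\<lambda>v. jump_rate E W x0 (L(i := L i - v)) i j)}"

text \<open>A state consists of the time of the last jump, the current vertex, and the remaining local times
  at the time of the last jump. The time becomes \<open>\<infinity>\<close> when no clock rings any more. Ties between clocks
  have probability 0.\<close>

definition next_jump ::
  "'v::finite set set \<Rightarrow> ('v set \<Rightarrow> real) \<Rightarrow> 'v \<Rightarrow> ('v \<Rightarrow> real) \<Rightarrow>
     ereal \<times> 'v \<times> ('v \<Rightarrow> real) \<Rightarrow> ereal \<times> 'v \<times> ('v \<Rightarrow> real)" where
  "next_jump E W x0 c = (\<lambda>(t, i, L).
     let \<tau> = (INF j. ring_time E W x0 L i c j) in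
     if \<tau> = \<infinity> then (\<infinity>, i, L)
     else (t + \<tau>, arg_min_on (ring_time E W x0 L i c) UNIV, L(i := L i - real_of_ereal \<tau>)))"

primrec jump_chain ::
  "'v::finite set set \<Rightarrow> ('v set \<Rightarrow> real) \<Rightarrow> 'v \<Rightarrow> ('v \<Rightarrow> real) \<Rightarrow> 'v \<Rightarrow> (nat \<Rightarrow> 'v \<Rightarrow> real) \<Rightarrow>
     nat \<Rightarrow> ereal \<times> 'v \<times> ('v \<Rightarrow> real)" where
  "jump_chain E W x0 \<Phi> z \<xi> 0 = (0, z, \<Phi>)"
| "jump_chain E W x0 \<Phi> z \<xi> (Suc n) = next_jump E W x0 (\<xi> n) (jump_chain E W x0 \<Phi> z \<xi> n)"

definition jump_time where
  "jump_time E W x0 \<Phi> z \<xi> n = fst (jump_chain E W x0 \<Phi> z \<xi> n)"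

definition jump_vertex where
  "jump_vertex E W x0 \<Phi> z \<xi> n = fst (snd (jump_chain E W x0 \<Phi> z \<xi> n))"

text \<open>The value \<open>None\<close> is a cemetery state, entered if infinitely many jumps occur in finite time: no
  continuation after an accumulation of jumps is built into the definition. After the last
  jump the path is constant.\<close>

definition Y_path ::
  "'v::finite set set \<Rightarrow> ('v set \<Rightarrow> real) \<Rightarrow> 'v \<Rightarrow> ('v \<Rightarrow> real) \<Rightarrow> 'v \<Rightarrow> (nat \<Rightarrow> 'v \<Rightarrow> real) \<Rightarrow>
     real \<Rightarrow> 'v option" where
  "Y_path E W x0 \<Phi> z \<xi> s =
     (if \<exists>n. ereal s < jump_time E W x0 \<Phi> z \<xi> (Suc n)
      then Some (jump_vertex E W x0 \<Phi> z \<xi> (LEAST n. ereal s < jump_time E W x0 \<Phi> z \<xi> (Suc n)))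
      else None)"


section \<open>Remaining local times and end of a path\<close>

definition remaining_time :: "('v \<Rightarrow> real) \<Rightarrow> (real \<Rightarrow> 'v option) \<Rightarrow> 'v \<Rightarrow> real \<Rightarrow> real" where
  "remaining_time \<Phi> y i s = \<Phi> i - integral {0..s} (\<lambda>r. if y r = Some i then 1 else 0)"

definition stop_time :: "('v \<Rightarrow> real) \<Rightarrow> (real \<Rightarrow> 'v option) \<Rightarrow> ereal" where
  "stop_time \<Phi> y = Sup {ereal s | s. 0 \<le> s \<and> (\<forall>i. remaining_time \<Phi> y i s > 0)}"

definition ends_at :: "(real \<Rightarrow> 'v option) \<Rightarrow> ereal \<Rightarrow> 'v \<Rightarrow> bool" where
  "ends_at y S x \<longleftrightarrow> (\<forall>\<^sub>F s in at_left (real_of_ereal S). y s = Some x)"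

end

theory Submission
  imports Defs "HOL-Real_Asymp.Real_Asymp"
begin

text \<open>
  Write \<open>M k L\<close> for the sum of \<open>\<sigma> k\<close> times the Ising weight over all spin configurations, at
  remaining local times \<open>L\<close> (this is \<open>spin_sum L k\<close>). The partition function cancels in the jump rate,
  which is therefore \<open>W\<^sub>i\<^sub>j L\<^sub>j M j L / M i L\<close>. Differentiating the Ising weights in \<open>L\<^sub>i\<close> and using
  \<open>\<sigma>\<^sub>i\<^sup>2 = 1\<close> gives \<open>\<partial> M i L / \<partial> L\<^sub>i = (\<Sum>j. W\<^sub>i\<^sub>j L\<^sub>j M j L)\<close>: the total jump rate at \<open>i\<close> is the
  logarithmic derivative of \<open>M i L\<close> in \<open>L\<^sub>i\<close>. Hence the total rate integrated over a stay of
  duration \<open>u\<close> at \<open>i\<close> is \<open>ln (M i L) - ln (M i (L(i := L i - u)))\<close> (\<open>hazard_sum\<close>). Everything below follows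
  from this formula.

  The process cannot use up the local time of \<open>i \<noteq> x0\<close>. When \<open>L\<^sub>i\<close> tends to 0, the spin at \<open>i\<close>
  decouples and is symmetric, so \<open>M i L\<close> tends to 0 and the integrated rate diverges.
  With finitely many clocks one of them must ring before, whatever the values of the clocks
  (\<open>some_clock_rings\<close>). So the last stay, if there is one, is at \<open>x0\<close>; its length is
  the remaining local time of \<open>x0\<close>, and the total time is finite.

  It remains to exclude infinitely many jumps. The probability that no jump occurs during
  a time \<open>v\<close> of a stay at \<open>i\<close> is \<open>M i (L(i := L i - v)) / M i L\<close>. In the density for
  jumping from \<open>i\<close> to \<open>j\<close> at time \<open>v\<close>, multiplied by the factor \<open>1 / M j\<close> at the next state, all
  values of \<open>M\<close> cancel except the initial one, and \<open>W\<^sub>i\<^sub>j L\<^sub>j / M i L\<close> is left. In other words,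
  the process is a Doob transform of the process with the bounded rates \<open>W\<^sub>i\<^sub>j L\<^sub>j\<close>. By
  induction on \<open>n\<close>, the probability of at least \<open>n\<close> jumps from \<open>(i, L)\<close> is at most
  \<open>C K\<^sup>n |L|\<^sup>n / (n! M i L)\<close> with \<open>|L|\<close> the sum of the local times, where a factor \<open>|L| / n\<close> is gained
  at each step because every stay consumes local time (\<open>jump_count_integral_le\<close>). This tends to 0.
  The induction peels off the first family of clocks; the law of the first ring is
  computed in \<open>first_ring_integral\<close>.
\<close>

section \<open>Positivity of the magnetization\<close>

definition chi :: "'v set \<Rightarrow> ('v \<Rightarrow> real) \<Rightarrow> real" where
  "chi A \<sigma> = (\<Prod>x\<in>A. \<sigma> x)"

lemma finite_spins [simp]: "finite (spins (x0 :: 'v::finite))"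
proof -
  have "finite (PiE (UNIV :: 'v set) (\<lambda>_. {-1, 1 :: real}))"
    by (intro finite_PiE) auto
  moreover have "spins x0 \<subseteq> PiE (UNIV :: 'v set) (\<lambda>_. {-1, 1 :: real})"
    by (auto simp: spins_def PiE_def)
  ultimately show ?thesis by (rule rev_finite_subset)
qed

lemma one_in_spins: "(\<lambda>_. 1) \<in> spins x0"
  by (simp add: spins_def)

lemma spin_cases: "\<sigma> \<in> spins x0 \<Longrightarrow> \<sigma> x = 1 \<or> \<sigma> x = -1"
  by (auto simp: spins_def)

lemma spin_square: "\<sigma> \<in> spins x0 \<Longrightarrow> \<sigma> x * \<sigma> x = 1"
  using spin_cases[of \<sigma> x0 x] by auto

lemma chi_cases:
  assumes "\<sigma> \<in> spins x0" shows "chi A \<sigma> = 1 \<or> chi A \<sigma> = -1"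
  unfolding chi_def
  by (induction A rule: infinite_finite_induct)
    (use spin_cases[OF assms] in \<open>auto, (metis minus_minus)+\<close>)

lemma chi_mult:
  fixes A B :: "'v::finite set"
  assumes "\<sigma> \<in> spins x0"
  shows "chi A \<sigma> * chi B \<sigma> = chi ((A - B) \<union> (B - A)) \<sigma>"
proof -
  have A: "chi A \<sigma> = chi (A - B) \<sigma> * chi (A \<inter> B) \<sigma>"
    unfolding chi_def by (subst prod.union_disjoint[symmetric]) (auto intro!: prod.cong)
  have B: "chi B \<sigma> = chi (B - A) \<sigma> * chi (A \<inter> B) \<sigma>"
    unfolding chi_def by (subst prod.union_disjoint[symmetric]) (auto intro!: prod.cong)
  have "chi ((A - B) \<union> (B - A)) \<sigma> = chi (A - B) \<sigma> * chi (B - A) \<sigma>"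
    unfolding chi_def by (subst prod.union_disjoint) auto
  moreover have "chi (A \<inter> B) \<sigma> * chi (A \<inter> B) \<sigma> = 1"
    using chi_cases[OF assms, of "A \<inter> B"] by auto
  ultimately show ?thesis unfolding A B
    by (metis (no_types, opaque_lifting) mult.assoc mult.commute mult.right_neutral)
qed

lemma sum_flip_eq_0:
  fixes f :: "('v::finite \<Rightarrow> real) \<Rightarrow> real"
  assumes "x \<noteq> x0"
    and odd: "\<And>\<sigma>. \<sigma> \<in> spins x0 \<Longrightarrow> f (\<sigma>(x := - \<sigma> x)) = - f \<sigma>"
  shows "(\<Sum>\<sigma>\<in>spins x0. f \<sigma>) = 0"
proof -
  have "(\<Sum>\<sigma>\<in>spins x0. f \<sigma>) = (\<Sum>\<sigma>\<in>spins x0. f (\<sigma>(x := - \<sigma> x)))"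
    by (rule sum.reindex_bij_witness[of _ "\<lambda>\<sigma>. \<sigma>(x := - \<sigma> x)" "\<lambda>\<sigma>. \<sigma>(x := - \<sigma> x)"])
      (use \<open>x \<noteq> x0\<close> in \<open>auto simp: spins_def\<close>)
  also have "\<dots> = - (\<Sum>\<sigma>\<in>spins x0. f \<sigma>)"
    by (simp add: odd sum_negf)
  finally show ?thesis by simp
qed

text \<open>A product of spins is constantly 1 if it involves at most \<open>x0\<close>; otherwise flipping one of its
  other spins shows that the sum vanishes.\<close>

lemma sum_chi_nonneg:
  fixes A :: "'v::finite set"
  shows "(\<Sum>\<sigma>\<in>spins x0. chi A \<sigma>) \<ge> 0"
proof (cases "\<exists>x\<in>A. x \<noteq> x0")
  case True
  then obtain x where x: "x \<in> A" "x \<noteq> x0" by auto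
  have "(\<Sum>\<sigma>\<in>spins x0. chi A \<sigma>) = 0"
  proof (rule sum_flip_eq_0[OF x(2)])
    fix \<sigma> :: "'v \<Rightarrow> real"
    have "(\<Prod>y\<in>A - {x}. (\<sigma>(x := - \<sigma> x)) y) = (\<Prod>y\<in>A - {x}. \<sigma> y)"
      by (intro prod.cong) auto
    then show "chi A (\<sigma>(x := - \<sigma> x)) = - chi A \<sigma>"
      unfolding chi_def using x(1) by (simp add: prod.remove[of A x])
  qed
  then show ?thesis by simp
next
  case False
  then have "chi A \<sigma> = 1" if "\<sigma> \<in> spins x0" for \<sigma>
    using that unfolding chi_def spins_def by (intro prod.neutral) auto
  then show ?thesis by (intro sum_nonneg) auto
qed

text \<open>The exponential of a sign is affine in that sign. For a nonnegative interaction
  the Ising weight is therefore a product of polynomials in the spins with nonnegative coefficients.\<close>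

lemma exp_chi:
  assumes "\<sigma> \<in> spins x0"
  shows "exp (a * chi A \<sigma>) = cosh a + sinh a * chi A \<sigma>"
  using chi_cases[OF assms, of A] cosh_plus_sinh[of a] cosh_minus_sinh[of a] by auto

lemma sum_chi_weight_insert:
  fixes F :: "'v::finite set set"
  assumes "e \<notin> F"
  shows "(\<Sum>\<sigma>\<in>spins x0. chi A \<sigma> * ising_weight (insert e F) J \<sigma>)
    = cosh (J e) * (\<Sum>\<sigma>\<in>spins x0. chi A \<sigma> * ising_weight F J \<sigma>)
    + sinh (J e) * (\<Sum>\<sigma>\<in>spins x0. chi ((A - e) \<union> (e - A)) \<sigma> * ising_weight F J \<sigma>)"
proof -
  have "chi A \<sigma> * ising_weight (insert e F) J \<sigma> =
      cosh (J e) * (chi A \<sigma> * ising_weight F J \<sigma>)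
      + sinh (J e) * (chi ((A - e) \<union> (e - A)) \<sigma> * ising_weight F J \<sigma>)" if "\<sigma> \<in> spins x0" for \<sigma>
  proof -
    have "ising_weight (insert e F) J \<sigma> = exp (J e * chi e \<sigma>) * ising_weight F J \<sigma>"
      using assms by (simp add: ising_weight_def chi_def exp_add)
    then show ?thesis
      unfolding exp_chi[OF that] chi_mult[OF that, symmetric] by (simp add: algebra_simps)
  qed
  then show ?thesis by (simp add: sum.distrib sum_distrib_left)
qed

text \<open>Griffiths' first inequality, for all products of spins at once so that it can be proved
  by adding the edges one at a time.\<close>

lemma griffiths:
  fixes F :: "'v::finite set set"
  assumes "\<And>e. e \<in> F \<Longrightarrow> J e \<ge> 0"
  shows "(\<Sum>\<sigma>\<in>spins x0. chi A \<sigma> * ising_weight F J \<sigma>) \<ge> 0"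
proof -
  have "finite F" by simp
  then show ?thesis using assms
  proof (induction F arbitrary: A rule: finite_induct)
    case empty
    then show ?case using sum_chi_nonneg by (simp add: ising_weight_def)
  next
    case (insert e F)
    then show ?case
      unfolding sum_chi_weight_insert[OF insert(2)]
      by (intro add_nonneg_nonneg mult_nonneg_nonneg) auto
  qed
qed

lemma ising_weight_pos: "ising_weight E J \<sigma> > 0"
  by (simp add: ising_weight_def)

lemma partition_function_pos: "(\<Sum>\<sigma>\<in>spins (x0 :: 'v::finite). ising_weight E J \<sigma>) > 0"
  by (intro sum_pos ising_weight_pos finite_spins) (use one_in_spins[of x0] in auto)

text \<open>Positivity spreads from \<open>x0\<close> along the edges: if the edge \<open>{j, k}\<close> is removed, both spin sums are
  nonnegative by Griffiths' inequality, and putting it back replaces each of the two by a combination of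
  both with positive coefficients. So if one of them is positive, then both are.\<close>

lemma spin_sum_pos:
  fixes E :: "'v::finite set set"
  assumes "loopless E" "connected_graph E" and J: "\<And>e. e \<in> E \<Longrightarrow> J e > 0"
  shows "(\<Sum>\<sigma>\<in>spins x0. \<sigma> i * ising_weight E J \<sigma>) > 0"
proof -
  let ?S = "\<lambda>i. \<Sum>\<sigma>\<in>spins x0. chi {i} \<sigma> * ising_weight E J \<sigma>"
  have "(\<lambda>a b. {a, b} \<in> E)\<^sup>*\<^sup>* x0 i"
    using assms(2) by (simp add: connected_graph_def)
  then have "?S i > 0"
  proof (induction rule: rtranclp_induct)
    case base
    have "?S x0 = (\<Sum>\<sigma>\<in>spins x0. ising_weight E J \<sigma>)"
      by (intro sum.cong) (auto simp: chi_def spins_def)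
    then show ?case using partition_function_pos by metis
  next
    case (step j k)
    have jk: "j \<noteq> k"
      using assms(1) step(2) unfolding loopless_def by (metis doubleton_eq_iff)
    define F where "F = E - {{j, k}}"
    have E: "E = insert {j, k} F" and nF: "{j, k} \<notin> F"
      using step(2) by (auto simp: F_def)
    define a where "a = (\<lambda>i. \<Sum>\<sigma>\<in>spins x0. chi {i} \<sigma> * ising_weight F J \<sigma>)"
    have nn: "a i \<ge> 0" for i
      unfolding a_def using J by (intro griffiths) (auto simp: F_def less_imp_le)
    have Jp: "J {j, k} > 0" using J step(2) by auto
    have "({j} - {j, k}) \<union> ({j, k} - {j}) = {k}" "({k} - {j, k}) \<union> ({j, k} - {k}) = {j}"
      using jk by auto
    then have Sj: "?S j = cosh (J {j, k}) * a j + sinh (J {j, k}) * a k"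
      and Sk: "?S k = cosh (J {j, k}) * a k + sinh (J {j, k}) * a j"
      unfolding E sum_chi_weight_insert[OF nF] a_def by simp_all
    have "a j > 0 \<or> a k > 0"
      using step(3) nn[of j] nn[of k] unfolding Sj by (auto simp: less_le)
    then show ?case
      unfolding Sk using Jp nn[of j] nn[of k]
      by (auto intro: add_nonneg_pos add_pos_nonneg)
  qed
  then show ?thesis by (simp add: chi_def)
qed

section \<open>Jump rates as logarithmic derivatives\<close>

locale ising_graph =
  fixes E :: "'v::finite set set" and W :: "'v set \<Rightarrow> real" and x0 :: 'v
  assumes loopless: "loopless E"
    and connected: "connected_graph E"
    and W_pos: "\<And>e. e \<in> E \<Longrightarrow> W e > 0"
begin

definition spin_sum :: "('v \<Rightarrow> real) \<Rightarrow> 'v \<Rightarrow> real" where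
  "spin_sum L k = (\<Sum>\<sigma>\<in>spins x0. \<sigma> k * ising_weight E (\<lambda>e. W e * (\<Prod>x\<in>e. L x)) \<sigma>)"

abbreviation "cond \<equiv> conductance E W"

definition rate :: "('v \<Rightarrow> real) \<Rightarrow> 'v \<Rightarrow> 'v \<Rightarrow> real \<Rightarrow> real" where
  "rate L i j v = jump_rate E W x0 (L(i := L i - v)) i j"

definition hazard :: "('v \<Rightarrow> real) \<Rightarrow> 'v \<Rightarrow> 'v \<Rightarrow> real \<Rightarrow> real" where
  "hazard L i j u = integral {0..u} (rate L i j)"

lemma ring_time_eq:
  "ring_time E W x0 L i c j = Inf {ereal u | u. 0 \<le> u \<and> u < L i \<and> c j \<le> hazard L i j u}"
  by (simp add: ring_time_def hazard_def rate_def[abs_def])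

lemma no_loop: "{i, j} \<in> E \<Longrightarrow> i \<noteq> j"
  using loopless unfolding loopless_def by (metis doubleton_eq_iff)

lemma cond_diag [simp]: "cond i i = 0"
  using no_loop[of i i] by (auto simp: conductance_def)

lemma cond_nonneg: "cond i j \<ge> 0"
  using W_pos by (auto simp: conductance_def less_imp_le)

lemma cond_fun_upd: "cond i j * (L(i := t)) j = cond i j * L j"
  by (cases "i = j") auto

lemma spin_sum_positive: "(\<And>x. L x > 0) \<Longrightarrow> spin_sum L k > 0"
  unfolding spin_sum_def using W_pos
  by (intro spin_sum_pos loopless connected mult_pos_pos prod_pos) auto

lemma jump_rate_eq: "jump_rate E W x0 L i j = cond i j * L j * spin_sum L j / spin_sum L i"
proof -
  have "(\<Sum>\<sigma>\<in>spins x0. ising_weight E (\<lambda>e. W e * (\<Prod>x\<in>e. L x)) \<sigma>) \<noteq> 0"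
    using partition_function_pos[where ?x0.0 = x0] by (metis less_irrefl)
  then show ?thesis
    by (simp add: jump_rate_def magnetization_def ising_expectation_def spin_sum_def)
qed

text \<open>Since there are no loops, every edge contains \<open>i\<close> at most once, and the energy is affine in the
  local time of \<open>i\<close>.\<close>

lemma energy_fun_upd:
  "(\<Sum>e\<in>E. (W e * (\<Prod>x\<in>e. (L(i := t)) x)) * (\<Prod>x\<in>e. \<sigma> x)) =
     (\<Sum>e\<in>{e\<in>E. i \<notin> e}. (W e * (\<Prod>x\<in>e. L x)) * (\<Prod>x\<in>e. \<sigma> x))
     + t * (\<sigma> i * (\<Sum>j\<in>UNIV. cond i j * L j * \<sigma> j))"
proof -
  let ?g = "\<lambda>e. (W e * (\<Prod>x\<in>e. (L(i := t)) x)) * (\<Prod>x\<in>e. \<sigma> x)"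
  have "sum ?g E = sum ?g {e\<in>E. i \<notin> e} + sum ?g {e\<in>E. i \<in> e}"
    by (subst sum.union_disjoint[symmetric]) (auto intro!: sum.cong)
  also have "sum ?g {e\<in>E. i \<notin> e} =
      (\<Sum>e\<in>{e\<in>E. i \<notin> e}. (W e * (\<Prod>x\<in>e. L x)) * (\<Prod>x\<in>e. \<sigma> x))"
    by (intro sum.cong arg_cong2[where f = "(*)"] prod.cong) auto
  also have "sum ?g {e\<in>E. i \<in> e} = (\<Sum>j | {i, j} \<in> E. ?g {i, j})"
  proof (rule sum.reindex_bij_betw[symmetric])
    show "bij_betw (\<lambda>j. {i, j}) {j. {i, j} \<in> E} {e \<in> E. i \<in> e}"
    proof (rule bij_betw_imageI)
      show "inj_on (\<lambda>j. {i, j}) {j. {i, j} \<in> E}"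
        by (rule inj_onI) (metis doubleton_eq_iff)
      have "e \<in> (\<lambda>j. {i, j}) ` {j. {i, j} \<in> E}" if e: "e \<in> E" "i \<in> e" for e
      proof -
        obtain x y where "e = {x, y}" using loopless e(1) by (auto simp: loopless_def)
        with e(2) have "e = {i, x} \<or> e = {i, y}" by auto
        then show ?thesis using e(1) by auto
      qed
      then show "(\<lambda>j. {i, j}) ` {j. {i, j} \<in> E} = {e \<in> E. i \<in> e}" by auto
    qed
  qed
  also have "\<dots> = (\<Sum>j | {i, j} \<in> E. t * (\<sigma> i * (cond i j * L j * \<sigma> j)))"
    by (intro sum.cong) (use no_loop in \<open>auto simp: conductance_def\<close>)
  also have "\<dots> = (\<Sum>j\<in>UNIV. t * (\<sigma> i * (cond i j * L j * \<sigma> j)))"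
    by (intro sum.mono_neutral_left) (auto simp: conductance_def)
  finally show ?thesis by (simp add: sum_distrib_left)
qed

lemma spin_sum_fun_upd:
  "spin_sum (L(i := t)) k = (\<Sum>\<sigma>\<in>spins x0. \<sigma> k *
     exp ((\<Sum>e\<in>{e\<in>E. i \<notin> e}. (W e * (\<Prod>x\<in>e. L x)) * (\<Prod>x\<in>e. \<sigma> x))
       + t * (\<sigma> i * (\<Sum>j\<in>UNIV. cond i j * L j * \<sigma> j))))"
  unfolding spin_sum_def ising_weight_def energy_fun_upd ..

text \<open>The factor \<open>\<sigma> i\<close> produced by differentiating the weight cancels the one in front of it, which leaves
  the spins of the neighbours of \<open>i\<close>.\<close>

lemma spin_sum_deriv:
  "((\<lambda>t. spin_sum (L(i := t)) i) has_real_derivative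
      (\<Sum>j\<in>UNIV. cond i j * L j * spin_sum (L(i := t)) j)) (at t)"
proof -
  define a where "a = (\<lambda>\<sigma>. \<Sum>e\<in>{e\<in>E. i \<notin> e}. (W e * (\<Prod>x\<in>e. L x)) * (\<Prod>x\<in>e. \<sigma> x))"
  define b where "b = (\<lambda>\<sigma>. \<Sum>j\<in>UNIV. cond i j * L j * \<sigma> j)"
  define w where "w = (\<lambda>t \<sigma>. exp (a \<sigma> + t * (\<sigma> i * b \<sigma>)))"
  have S: "spin_sum (L(i := t)) k = (\<Sum>\<sigma>\<in>spins x0. \<sigma> k * w t \<sigma>)" for t k
    unfolding spin_sum_fun_upd a_def b_def w_def ..
  have "((\<lambda>t. \<Sum>\<sigma>\<in>spins x0. \<sigma> i * w t \<sigma>) has_real_derivative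
      (\<Sum>\<sigma>\<in>spins x0. w t \<sigma> * b \<sigma>)) (at t)"
  proof (rule DERIV_sum)
    fix \<sigma> assume \<sigma>: "\<sigma> \<in> spins x0"
    have "((\<lambda>t. \<sigma> i * w t \<sigma>) has_real_derivative \<sigma> i * (w t \<sigma> * (\<sigma> i * b \<sigma>))) (at t)"
      unfolding w_def by (auto intro!: derivative_eq_intros)
    also have "\<sigma> i * (w t \<sigma> * (\<sigma> i * b \<sigma>)) = (\<sigma> i * \<sigma> i) * (w t \<sigma> * b \<sigma>)"
      by (simp only: mult_ac)
    finally show "((\<lambda>t. \<sigma> i * w t \<sigma>) has_real_derivative w t \<sigma> * b \<sigma>) (at t)"
      by (simp add: spin_square[OF \<sigma>])
  qed
  also have "(\<Sum>\<sigma>\<in>spins x0. w t \<sigma> * b \<sigma>) =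
      (\<Sum>j\<in>UNIV. cond i j * L j * (\<Sum>\<sigma>\<in>spins x0. \<sigma> j * w t \<sigma>))"
    unfolding b_def sum_distrib_left
    by (subst sum.swap) (intro sum.cong refl, simp only: mult_ac)
  finally show ?thesis unfolding S .
qed

lemma spin_sum_continuous [continuous_intros]:
  "continuous_on A f \<Longrightarrow> continuous_on A (\<lambda>t. spin_sum (L(i := f t)) k)"
  unfolding spin_sum_fun_upd by (intro continuous_intros)

text \<open>At local time 0 the spin at \<open>i\<close> no longer interacts, so flipping it changes only the sign.\<close>

lemma spin_sum_at_0:
  assumes "i \<noteq> x0" shows "spin_sum (L(i := 0)) i = 0"
proof -
  define a where "a = (\<lambda>\<sigma>. \<Sum>e\<in>{e\<in>E. i \<notin> e}. (W e * (\<Prod>x\<in>e. L x)) * (\<Prod>x\<in>e. \<sigma> x))"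
  have "a (\<sigma>(i := - \<sigma> i)) = a \<sigma>" for \<sigma>
    unfolding a_def by (intro sum.cong arg_cong2[where f = "(*)"] prod.cong) auto
  then have "(\<Sum>\<sigma>\<in>spins x0. \<sigma> i * exp (a \<sigma>)) = 0"
    by (intro sum_flip_eq_0[OF assms]) (simp only: fun_upd_same mult_minus_left)
  moreover have "spin_sum (L(i := 0)) i = (\<Sum>\<sigma>\<in>spins x0. \<sigma> i * exp (a \<sigma>))"
    unfolding spin_sum_fun_upd a_def by simp
  ultimately show ?thesis by simp
qed

end

text \<open>A stay at \<open>i\<close> which begins with remaining local times \<open>L\<close>.\<close>

locale stay = ising_graph E W x0 for E :: "'v::finite set set" and W x0 +
  fixes L :: "'v \<Rightarrow> real" and i :: 'v
  assumes L_pos: "\<And>x. L x > 0"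
begin

lemma L_upd_pos: "v < L i \<Longrightarrow> (L(i := L i - v)) x > 0"
  using L_pos by auto

lemma spin_sum_upd_pos: "v < L i \<Longrightarrow> spin_sum (L(i := L i - v)) k > 0"
  by (rule spin_sum_positive[OF L_upd_pos])

lemma rate_eq:
  "rate L i j v = cond i j * L j * spin_sum (L(i := L i - v)) j / spin_sum (L(i := L i - v)) i"
  unfolding rate_def jump_rate_eq cond_fun_upd ..

lemma rate_nonneg: "v < L i \<Longrightarrow> rate L i j v \<ge> 0"
  unfolding rate_eq
  by (intro divide_nonneg_nonneg mult_nonneg_nonneg cond_nonneg less_imp_le[OF L_pos]
      less_imp_le[OF spin_sum_upd_pos])

lemma rate_pos:
  assumes "{i, j} \<in> E" "v < L i" shows "rate L i j v > 0"
proof -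
  have "cond i j > 0" using W_pos assms by (simp add: conductance_def)
  then show ?thesis
    unfolding rate_eq by (intro divide_pos_pos mult_pos_pos L_pos spin_sum_upd_pos assms)
qed

lemma rate_not_adjacent: "{i, j} \<notin> E \<Longrightarrow> rate L i j v = 0"
  unfolding rate_eq by (simp add: conductance_def)

lemma rate_continuous:
  assumes "A \<subseteq> {..<L i}" shows "continuous_on A (rate L i j)"
proof -
  have "spin_sum (L(i := L i - v)) i \<noteq> 0" if "v \<in> A" for v
    using spin_sum_upd_pos[of v i] that assms by auto
  then show ?thesis
    unfolding rate_eq[abs_def] by (intro continuous_intros ballI)
qed

lemma rate_integrable: "b < L i \<Longrightarrow> rate L i j integrable_on {a..b}"
  by (intro integrable_continuous_interval rate_continuous) auto

lemma hazard_nonneg: "u < L i \<Longrightarrow> hazard L i j u \<ge> 0"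
  unfolding hazard_def by (rule integral_nonneg) (auto intro: rate_integrable rate_nonneg)

lemma hazard_mono: "u \<le> v \<Longrightarrow> v < L i \<Longrightarrow> hazard L i j u \<le> hazard L i j v"
  unfolding hazard_def by (intro integral_subset_le rate_integrable) (auto intro: rate_nonneg)

lemma hazard_continuous:
  assumes "b < L i" shows "continuous_on {0..b} (hazard L i j)"
  unfolding hazard_def by (rule indefinite_integral_continuous_1[OF rate_integrable[OF assms]])

lemma hazard_strict_mono:
  assumes "{i, j} \<in> E" "0 \<le> u" "u < v" "v < L i"
  shows "hazard L i j u < hazard L i j v"
proof -
  have "continuous_on {u..v} (rate L i j)" using assms by (intro rate_continuous) auto
  then obtain c where c: "c \<in> {u..v}" "\<And>x. x \<in> {u..v} \<Longrightarrow> rate L i j c \<le> rate L i j x"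
    using continuous_attains_inf[of "{u..v}" "rate L i j"] assms by auto
  have "0 < rate L i j c * (v - u)"
    using c(1) assms by (intro mult_pos_pos rate_pos) auto
  also have "\<dots> = integral {u..v} (\<lambda>_. rate L i j c)" using assms by simp
  also have "\<dots> \<le> integral {u..v} (rate L i j)"
    using c(2) assms by (intro integral_le rate_integrable) auto
  also have "hazard L i j u + integral {u..v} (rate L i j) = hazard L i j v"
    unfolding hazard_def using assms by (intro Henstock_Kurzweil_Integration.integral_combine rate_integrable) auto
  then have "integral {u..v} (rate L i j) = hazard L i j v - hazard L i j u" by simp
  finally show ?thesis by simp
qed

text \<open>The sum of the rates is minus the derivative of \<open>ln (spin_sum (L(i := L i - v)) i)\<close> in \<open>v\<close>.\<close>

lemma hazard_sum:
  assumes "0 \<le> u" "u < L i"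
  shows "(\<Sum>j\<in>UNIV. hazard L i j u) = ln (spin_sum L i) - ln (spin_sum (L(i := L i - u)) i)"
proof -
  let ?M = "\<lambda>v k. spin_sum (L(i := L i - v)) k"
  have D: "((\<lambda>v. - ln (?M v i)) has_real_derivative (\<Sum>j\<in>UNIV. rate L i j v)) (at v)"
    if "v < L i" for v
  proof -
    have "((\<lambda>t. spin_sum (L(i := t)) i) \<circ> (\<lambda>v. L i - v) has_real_derivative
        (\<Sum>j\<in>UNIV. cond i j * L j * ?M v j) * (- 1)) (at v)"
      by (rule DERIV_chain[OF spin_sum_deriv]) (auto intro!: derivative_eq_intros)
    then have "((\<lambda>v. ?M v i) has_real_derivative
        - (\<Sum>j\<in>UNIV. cond i j * L j * ?M v j)) (at v)"
      by (simp add: o_def)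
    from DERIV_minus[OF DERIV_chain2[OF DERIV_ln_divide[OF spin_sum_upd_pos[OF that]] this]]
    show ?thesis by (simp add: rate_eq sum_divide_distrib)
  qed
  have "((\<lambda>v. \<Sum>j\<in>UNIV. rate L i j v) has_integral (- ln (?M u i) - (- ln (?M 0 i)))) {0..u}"
  proof (rule fundamental_theorem_of_calculus[OF assms(1)])
    fix v assume "v \<in> {0..u}"
    with assms have "v < L i" by simp
    from has_vector_derivative_at_within[OF
        D[OF this, unfolded has_real_derivative_iff_has_vector_derivative]]
    show "((\<lambda>v. - ln (?M v i)) has_vector_derivative (\<Sum>j\<in>UNIV. rate L i j v))
        (at v within {0..u})" .
  qed
  moreover have "((\<lambda>v. \<Sum>j\<in>UNIV. rate L i j v) has_integral (\<Sum>j\<in>UNIV. hazard L i j u)) {0..u}"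
    unfolding hazard_def using assms by (intro has_integral_sum integrable_integral rate_integrable) auto
  ultimately show ?thesis by (simp add: has_integral_iff)
qed

lemma ring_time_finite_iff:
  "ring_time E W x0 L i c j < \<infinity> \<longleftrightarrow> (\<exists>u\<ge>0. u < L i \<and> c j \<le> hazard L i j u)"
  unfolding ring_time_eq Inf_less_iff by auto

lemma ring_time_nonneg: "ring_time E W x0 L i c j \<ge> 0"
  unfolding ring_time_eq by (rule Inf_greatest) auto

lemma ring_time_less:
  assumes "ring_time E W x0 L i c j < \<infinity>" shows "ring_time E W x0 L i c j < L i"
proof -
  obtain u where "u \<ge> 0" "u < L i" "c j \<le> hazard L i j u"
    using assms unfolding ring_time_finite_iff by auto
  then have "ring_time E W x0 L i c j \<le> ereal u"
    unfolding ring_time_eq by (intro Inf_lower) auto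
  then show ?thesis using \<open>u < L i\<close> by (simp add: le_less_trans)
qed

text \<open>If no clock rang, the integrated rates would stay below the sum of the clocks, whereas by
  \<open>hazard_sum\<close> they diverge as the spin sum at \<open>i\<close> approaches 0. This holds for every value
  of the clocks, so no null set is discarded.\<close>

lemma some_clock_rings:
  assumes "i \<noteq> x0" shows "\<exists>j. ring_time E W x0 L i c j < \<infinity>"
proof (rule ccontr)
  assume "\<not> ?thesis"
  then have *: "hazard L i j u < c j" if "0 \<le> u" "u < L i" for u j
    using that unfolding ring_time_finite_iff by (meson not_le)
  \<comment> \<open>the lower bound on the spin sum that \<open>hazard_sum\<close> yields if the total hazard is at most \<open>\<Sum>j. c j\<close>\<close>
  define \<delta> where "\<delta> = exp (ln (spin_sum L i) - (\<Sum>j\<in>UNIV. c j))"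
  have lower: "\<delta> \<le> spin_sum (L(i := L i - u)) i" if "0 \<le> u" "u < L i" for u
  proof -
    have "(\<Sum>j\<in>UNIV. hazard L i j u) \<le> (\<Sum>j\<in>UNIV. c j)"
      by (intro sum_mono less_imp_le * that)
    then have "ln (spin_sum L i) - (\<Sum>j\<in>UNIV. c j) \<le> ln (spin_sum (L(i := L i - u)) i)"
      unfolding hazard_sum[OF that] by simp
    then show ?thesis
      unfolding \<delta>_def using spin_sum_upd_pos[OF that(2)] by (metis exp_le_cancel_iff exp_ln)
  qed
  have "isCont (\<lambda>u. spin_sum (L(i := L i - u)) i) (L i)"
    using spin_sum_continuous[of UNIV "\<lambda>u. L i - u" L i i]
    by (simp add: continuous_on_eq_continuous_at continuous_intros)
  then have "((\<lambda>u. spin_sum (L(i := L i - u)) i) \<longlongrightarrow> 0) (at_left (L i))"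
    using spin_sum_at_0[OF assms, of L] by (auto simp: isCont_def filterlim_at_split)
  moreover have "\<forall>\<^sub>F u in at_left (L i). \<delta> \<le> spin_sum (L(i := L i - u)) i"
    unfolding eventually_at_left_field using lower L_pos[of i]
    by (intro exI[of _ 0]) auto
  ultimately have "\<delta> \<le> 0"
    by (rule tendsto_lowerbound) simp
  then show False by (simp add: \<delta>_def)
qed

end

section \<open>Measurability of the ringing times\<close>

abbreviation local_times :: "('v \<Rightarrow> real) measure" where
  "local_times \<equiv> \<Pi>\<^sub>M x\<in>UNIV. borel"

abbreviation exp_clock :: "real measure" where
  "exp_clock \<equiv> density lborel (exponential_density 1)"

context ising_graph
begin

lemma measurable_spin_sum [measurable]:
  "(\<lambda>L. spin_sum L k) \<in> borel_measurable local_times"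
  unfolding spin_sum_def ising_weight_def by measurable

lemma measurable_shift_local_time:
  "(\<lambda>x. (fst x)(i := fst x i - snd x)) \<in> local_times \<Otimes>\<^sub>M borel \<rightarrow>\<^sub>M local_times"
  by (rule measurable_PiM_single') (auto simp: space_PiM)

lemma measurable_rate:
  "(\<lambda>x. rate (fst x) i j (snd x)) \<in> borel_measurable (local_times \<Otimes>\<^sub>M borel)"
proof -
  have 1: "(\<lambda>L. jump_rate E W x0 L i j) \<in> borel_measurable local_times"
    unfolding jump_rate_eq by measurable
  show ?thesis
    unfolding rate_def by (rule measurable_compose[OF measurable_shift_local_time 1])
qed

text \<open>A Lebesgue integral in place of the gauge integral, so that it depends measurably on \<open>L\<close>
  and \<open>u\<close> together, without restriction to the set where the rates are continuous.\<close>

definition hazard_leb :: "('v \<Rightarrow> real) \<Rightarrow> 'v \<Rightarrow> 'v \<Rightarrow> real \<Rightarrow> real" where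
  "hazard_leb L i j u = (LINT v:{0..u}|lborel. rate L i j v)"

lemma measurable_hazard_leb:
  "(\<lambda>x. hazard_leb (fst x) i j (snd x)) \<in> borel_measurable (local_times \<Otimes>\<^sub>M borel)"
proof -
  have [measurable]: "(\<lambda>x. rate (fst (fst x)) i j (snd x))
      \<in> borel_measurable ((local_times \<Otimes>\<^sub>M borel) \<Otimes>\<^sub>M lborel)"
    by (rule measurable_compose[of "\<lambda>x. (fst (fst x), snd x)", OF _ measurable_rate, simplified]) measurable
  have "(\<lambda>x. indicator {0..snd (fst x)} (snd x) *\<^sub>R rate (fst (fst x)) i j (snd x))
      \<in> borel_measurable ((local_times \<Otimes>\<^sub>M borel) \<Otimes>\<^sub>M lborel)"
    unfolding indicator_def atLeastAtMost_iff by measurable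
  then show ?thesis
    unfolding hazard_leb_def set_lebesgue_integral_def
    by (intro lborel.borel_measurable_lebesgue_integral) (simp add: case_prod_beta')
qed

text \<open>The ringing time as a countable infimum, which makes it jointly measurable in the local times and the clock.
  Since the hazard is monotone, rational times suffice.\<close>

definition ring_at :: "('v \<Rightarrow> real) \<Rightarrow> 'v \<Rightarrow> 'v \<Rightarrow> real \<Rightarrow> ereal" where
  "ring_at L i j y =
     (INF q\<in>{q\<in>\<rat>. 0 \<le> q}. if q < L i \<and> y \<le> hazard_leb L i j q then ereal q else \<infinity>)"

lemma measurable_ring_at:
  "(\<lambda>x. ring_at (fst x) i j (snd x)) \<in> borel_measurable (local_times \<Otimes>\<^sub>M borel)"
proof -
  have [measurable]: "(\<lambda>x. hazard_leb (fst x) i j q) \<in> borel_measurable (local_times \<Otimes>\<^sub>M borel)" for q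
    by (rule measurable_compose[of "\<lambda>x. (fst x, q)", OF _ measurable_hazard_leb, simplified]) measurable
  have [simp]: "countable {q \<in> \<rat>. 0 \<le> q}"
    by (rule countable_subset[OF _ countable_rat]) auto
  show ?thesis
    unfolding ring_at_def by (intro borel_measurable_INF) measurable
qed

definition rings_first :: "('v \<Rightarrow> real) \<Rightarrow> 'v \<Rightarrow> ('v \<Rightarrow> real) \<Rightarrow> 'v \<Rightarrow> bool" where
  "rings_first L i c j \<longleftrightarrow>
     ring_at L i j (c j) < \<infinity> \<and> (\<forall>k. ring_at L i j (c j) \<le> ring_at L i k (c k))"

text \<open>A measurable function that is at least 1 whenever \<open>n\<close> jumps occur after a stay at \<open>i\<close> with local times \<open>L\<close>
  has begun. Summing over all clocks that ring first, instead of selecting one of them, avoids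
  the choice made at ties.
  The recursion is on the first jump, so that its integral can be estimated by
  induction through the product structure of the clocks.\<close>

primrec jump_count :: "nat \<Rightarrow> 'v \<Rightarrow> ('v \<Rightarrow> real) \<Rightarrow> (nat \<Rightarrow> 'v \<Rightarrow> real) \<Rightarrow> ennreal" where
  "jump_count 0 i L \<xi> = 1"
| "jump_count (Suc n) i L \<xi> =
     (\<Sum>j\<in>UNIV. if rings_first L i (\<xi> 0) j
       then jump_count n j (L(i := L i - real_of_ereal (ring_at L i j (\<xi> 0 j)))) (\<lambda>m. \<xi> (Suc m))
       else 0)"

lemma measurable_jump_count:
  "(\<lambda>x. jump_count n i (fst x) (snd x)) \<in>
     borel_measurable (local_times \<Otimes>\<^sub>M (\<Pi>\<^sub>M n\<in>UNIV. \<Pi>\<^sub>M j\<in>UNIV. borel))"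
proof (induction n arbitrary: i)
  case 0
  then show ?case by simp
next
  case (Suc n)
  let ?M = "local_times \<Otimes>\<^sub>M (\<Pi>\<^sub>M n\<in>UNIV. local_times) :: (('v \<Rightarrow> real) \<times> (nat \<Rightarrow> 'v \<Rightarrow> real)) measure"
  have [measurable]: "(\<lambda>x. snd x m j) \<in> borel_measurable ?M" for m j
    by (rule measurable_compose[OF measurable_compose[OF measurable_snd
          measurable_component_singleton[of m UNIV]] measurable_component_singleton[of j UNIV]]) auto
  have r[measurable]: "(\<lambda>x. ring_at (fst x) i j (snd x 0 j)) \<in> borel_measurable ?M" for j
    by (rule measurable_compose[of "\<lambda>x. (fst x, snd x 0 j)", OF _ measurable_ring_at, simplified]) measurable
  have first[measurable]: "Measurable.pred ?M (\<lambda>x. rings_first (fst x) i (snd x 0) j)" for j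
    unfolding rings_first_def by measurable
  have "(\<lambda>x. ((fst x)(i := fst x i - real_of_ereal (ring_at (fst x) i j (snd x 0 j))), \<lambda>m. snd x (Suc m)))
      \<in> ?M \<rightarrow>\<^sub>M ?M" for j
  proof (rule measurable_Pair)
    show "(\<lambda>x. (fst x)(i := fst x i - real_of_ereal (ring_at (fst x) i j (snd x 0 j)))) \<in> ?M \<rightarrow>\<^sub>M local_times"
      by (rule measurable_compose[of "\<lambda>x. (fst x, real_of_ereal (ring_at (fst x) i j (snd x 0 j)))",
          OF _ measurable_shift_local_time, simplified]) measurable
    show "(\<lambda>x m. snd x (Suc m)) \<in> ?M \<rightarrow>\<^sub>M (\<Pi>\<^sub>M n\<in>UNIV. local_times)"
      by (rule measurable_PiM_single') (auto simp: space_PiM)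
  qed
  from measurable_compose[OF this Suc] have [measurable]:
    "(\<lambda>x. jump_count n j ((fst x)(i := fst x i - real_of_ereal (ring_at (fst x) i j (snd x 0 j))))
        (\<lambda>m. snd x (Suc m))) \<in> borel_measurable ?M" for j
    by (simp only: fst_conv snd_conv)
  show ?case by simp
qed

end

context stay
begin

lemma hazard_leb_eq: "u < L i \<Longrightarrow> hazard_leb L i j u = hazard L i j u"
  unfolding hazard_leb_def hazard_def
  by (intro set_borel_integral_eq_integral borel_integrable_atLeastAtMost' rate_continuous) auto

lemma ring_at_eq: "ring_at L i j y = Inf {ereal u | u. 0 \<le> u \<and> u < L i \<and> y \<le> hazard L i j u}"
proof (rule antisym)
  show "Inf {ereal u | u. 0 \<le> u \<and> u < L i \<and> y \<le> hazard L i j u} \<le> ring_at L i j y"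
    unfolding ring_at_def by (intro INF_greatest) (auto intro!: Inf_lower simp: hazard_leb_eq)
  show "ring_at L i j y \<le> Inf {ereal u | u. 0 \<le> u \<and> u < L i \<and> y \<le> hazard L i j u}"
  proof (rule Inf_greatest, safe)
    fix u assume u: "0 \<le> u" "u < L i" "y \<le> hazard L i j u"
    show "ring_at L i j y \<le> ereal u"
    proof (rule ccontr)
      assume "\<not> ?thesis"
      then have "ereal u < ring_at L i j y" by (simp only: not_le)
      then obtain r where r: "u < r" "ereal r < ring_at L i j y"
        using ereal_dense2[of "ereal u" "ring_at L i j y"] by auto
      obtain q where q: "q \<in> \<rat>" "u < q" "q < min r (L i)"
        using Rats_dense_in_real[of u "min r (L i)"] u r by auto
      have "y \<le> hazard_leb L i j q"
        using hazard_mono[of u q j] u q by (simp add: hazard_leb_eq)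
      then have "ring_at L i j y \<le> ereal q"
        unfolding ring_at_def using q u by (intro INF_lower2[of q]) auto
      then have "ring_at L i j y \<le> ereal r"
        using q by (meson ereal_less_eq(3) less_imp_le min_less_iff_conj order_trans)
      then show False using r(2) by simp
    qed
  qed
qed

lemma ring_time_eq_ring_at: "ring_time E W x0 L i c j = ring_at L i j (c j)"
  unfolding ring_time_eq ring_at_eq ..

lemma ring_at_finite_iff: "ring_at L i j y < \<infinity> \<longleftrightarrow> (\<exists>u\<ge>0. u < L i \<and> y \<le> hazard L i j u)"
  unfolding ring_at_eq Inf_less_iff by auto

lemma ring_at_finite:
  assumes "ring_at L i j y < \<infinity>"
  obtains v where "ring_at L i j y = ereal v" "0 \<le> v" "v < L i"
proof -
  have "0 \<le> ring_at L i j y" "ring_at L i j y < L i"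
    using ring_time_nonneg[of "\<lambda>_. y" j] ring_time_less[of "\<lambda>_. y" j] assms
    by (simp_all add: ring_time_eq_ring_at)
  then show ?thesis using that by (cases "ring_at L i j y") auto
qed

lemma ring_at_hazard:
  assumes "{i, j} \<in> E" "0 \<le> v" "v < L i"
  shows "ring_at L i j (hazard L i j v) = ereal v"
proof -
  have "0 \<le> u \<Longrightarrow> u < L i \<Longrightarrow> hazard L i j v \<le> hazard L i j u \<Longrightarrow> v \<le> u" for u
    using hazard_strict_mono[OF assms(1), of u v] assms by (meson not_le)
  then show ?thesis
    unfolding ring_at_eq using assms by (intro cInf_eq_minimum) auto
qed

lemma hazard_le_clock:
  assumes "ereal v \<le> ring_at L i k y" "0 < v" "v < L i"
  shows "hazard L i k v \<le> y"
proof -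
  have "hazard L i k u < y" if "0 \<le> u" "u < v" for u
  proof (rule ccontr)
    assume "\<not> ?thesis"
    then have "ring_at L i k y \<le> ereal u"
      unfolding ring_at_eq using that assms by (intro Inf_lower) auto
    with assms(1) have "ereal v \<le> ereal u" by (rule order_trans)
    then show False using that by simp
  qed
  moreover have "(hazard L i k \<longlongrightarrow> hazard L i k v) (at v within {0..v})"
    using hazard_continuous[of v k] assms by (auto simp: continuous_on_def)
  then have "(hazard L i k \<longlongrightarrow> hazard L i k v) (at_left v)"
    using assms at_within_Icc_at_left by metis
  moreover have "\<forall>\<^sub>F u in at_left v. 0 \<le> u \<and> u < v"
    unfolding eventually_at_left_field using assms by (intro exI[of _ 0]) auto
  ultimately show ?thesis
    by (intro tendsto_upperbound[of "hazard L i k" "hazard L i k v" "at_left v"])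
      (auto elim!: eventually_mono intro: less_imp_le)
qed

end

section \<open>The law of the first ring\<close>

lemma prob_space_exp_clock: "prob_space exp_clock"
  by (rule prob_space_exponential_density) simp

lemma emeasure_exp_clock_atLeast:
  assumes "0 \<le> h" shows "emeasure exp_clock {h..} = ennreal (exp (- h))"
proof -
  have "emeasure exp_clock {h..} = (\<integral>\<^sup>+x. ennreal (exp (- x)) * indicator {h..} x \<partial>lborel)"
    using assms by (subst emeasure_density)
      (auto intro!: nn_integral_cong simp: exponential_density_def split: split_indicator)
  also have "\<dots> = ennreal (0 - (- exp (- h)))"
  proof (rule nn_integral_FTC_atLeast)
    show "((\<lambda>x::real. - exp (- x)) \<longlongrightarrow> 0) at_top"
      using tendsto_minus[OF filterlim_compose[OF exp_at_bot filterlim_uminus_at_bot_at_top]] by simp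
  qed (auto intro!: derivative_eq_intros)
  finally show ?thesis by simp
qed

context stay
begin

text \<open>If \<open>j\<close> rings first, at time \<open>v\<close>, then every other clock has survived the hazard accumulated
  until \<open>v\<close>. The case \<open>v = 0\<close> is separate because clocks may be negative, on a null set.\<close>

lemma first_ring_pointwise:
  assumes "rings_first L i c j"
  shows "k \<noteq> j \<Longrightarrow> real_of_ereal (ring_at L i j (c j)) = 0 \<or>
    hazard_leb L i k (real_of_ereal (ring_at L i j (c j))) \<le> c k"
proof -
  have "ring_at L i j (c j) < \<infinity>" and le: "ring_at L i j (c j) \<le> ring_at L i k (c k)" for k
    using assms by (auto simp: rings_first_def)
  then obtain v where v: "ring_at L i j (c j) = ereal v" "0 \<le> v" "v < L i"
    by (elim ring_at_finite)
  then show ?thesis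
    using hazard_le_clock[of v k "c k"] le[of k] by (cases "v = 0") (auto simp: hazard_leb_eq)
qed

text \<open>Change of variables from the value of the clock \<open>j\<close> to the time at which it rings.\<close>

lemma clock_substitution:
  fixes f :: "real \<Rightarrow> ennreal"
  assumes [measurable]: "f \<in> borel_measurable borel" and b: "0 < b" "b < L i"
  shows "(\<integral>\<^sup>+y. f y * indicator {0..hazard L i j b} y \<partial>lborel) =
     (\<integral>\<^sup>+v. f (hazard L i j v) * ennreal (rate L i j v) * indicator {0..b} v \<partial>lborel)"
proof -
  \<comment> \<open>The substitution rule asks for two-sided derivatives at \<open>0\<close> and \<open>b\<close>; the rate is still
    continuous on an interval \<open>{-1..d}\<close> around \<open>{0..b}\<close>, and \<open>g\<close> extends the hazard to it.\<close>
  define d where "d = (b + L i) / 2"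
  have d: "b < d" "d < L i" using b by (auto simp: d_def)
  define g where "g = (\<lambda>v. integral {-1..v} (rate L i j) - integral {-1..0} (rate L i j))"
  have g: "g v = hazard L i j v" if "0 \<le> v" "v \<le> b" for v
    unfolding g_def hazard_def using that d
    by (subst Henstock_Kurzweil_Integration.integral_combine[where c = 0 and a = "-1", symmetric])
      (auto intro: rate_integrable)
  have "(\<integral>\<^sup>+y. f y * indicator {g 0..g b} y \<partial>lborel) =
      (\<integral>\<^sup>+v. f (g v) * ennreal (rate L i j v) * indicator {0..b} v \<partial>lborel)"
  proof (rule nn_integral_substitution_aux)
    fix v assume v: "v \<in> {0..b}"
    have "((\<lambda>v. integral {-1..v} (rate L i j)) has_real_derivative rate L i j v) (at v within {-1..d})"
      using v d by (intro integral_has_real_derivative rate_continuous) auto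
    then have "((\<lambda>v. integral {-1..v} (rate L i j)) has_real_derivative rate L i j v) (at v)"
      using v d by (subst (asm) at_within_Icc_at) auto
    then show "(g has_real_derivative rate L i j v) (at v)"
      unfolding g_def by (auto intro!: derivative_eq_intros)
  qed (use b in \<open>auto intro!: rate_continuous rate_nonneg\<close>)
  then have "(\<integral>\<^sup>+y. f y * indicator {0..hazard L i j b} y \<partial>lborel) =
      (\<integral>\<^sup>+v. f (g v) * ennreal (rate L i j v) * indicator {0..b} v \<partial>lborel)"
    using g[of 0] g[of b] b by (simp add: hazard_def)
  also have "(\<integral>\<^sup>+v. f (g v) * ennreal (rate L i j v) * indicator {0..b} v \<partial>lborel) =
     (\<integral>\<^sup>+v. f (hazard L i j v) * ennreal (rate L i j v) * indicator {0..b} v \<partial>lborel)"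
    by (intro nn_integral_cong) (auto simp: g split: split_indicator)
  finally show ?thesis .
qed

text \<open>In density form: \<open>j\<close> rings first at time \<open>v\<close> with density \<open>exp (- (\<Sum>k. hazard L i k v)) * rate L i j v\<close>.
  The assumption concerns compact parts \<open>{0..b}\<close> of the stay, which keeps away from the
  possible singularity of the rates at \<open>L i\<close>. The integral over the clocks other than \<open>j\<close> yields
  their survival probabilities at the ringing time of \<open>j\<close>; the integral over the clock \<open>j\<close> is then turned
  into one over its ringing time.\<close>

lemma first_ring_integral:
  fixes f :: "real \<Rightarrow> ennreal"
  assumes f[measurable]: "f \<in> borel_measurable borel"
    and bound: "\<And>b. 0 < b \<Longrightarrow> b < L i \<Longrightarrow>
      (\<integral>\<^sup>+v. f v * ennreal (exp (- (\<Sum>k\<in>UNIV. hazard L i k v))) * ennreal (rate L i j v)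
         * indicator {0..b} v \<partial>lborel) \<le> B"
  shows "(\<integral>\<^sup>+c. (if rings_first L i c j then f (real_of_ereal (ring_at L i j (c j))) else 0)
      \<partial>(\<Pi>\<^sub>M j\<in>UNIV. exp_clock)) \<le> B"
proof -
  interpret clk: prob_space exp_clock by (rule prob_space_exp_clock)
  interpret prod: product_prob_space "\<lambda>_. exp_clock" UNIV by unfold_locales
  define \<rho> where "\<rho> = (\<lambda>y. real_of_ereal (ring_at L i j y))"
  define g where "g = (\<lambda>y. if ring_at L i j y < \<infinity> then f (\<rho> y) else 0)"
  \<comment> \<open>\<open>H k y\<close> is the hazard of \<open>k\<close> at the time at which \<open>j\<close> rings if its clock has the value \<open>y\<close>.\<close>
  define H where "H = (\<lambda>k y. if \<rho> y = 0 then 0 else hazard_leb L i k (\<rho> y))"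
  have L[measurable]: "L \<in> space local_times" by (simp add: space_PiM)
  have [measurable]: "ring_at L i j \<in> borel_measurable borel"
    by (rule measurable_compose[of "\<lambda>y. (L, y)", OF _ measurable_ring_at, simplified]) measurable
  have [measurable]: "hazard_leb L i k \<in> borel_measurable borel" for k
    by (rule measurable_compose[of "\<lambda>y. (L, y)", OF _ measurable_hazard_leb, simplified]) measurable
  have [measurable]: "\<rho> \<in> borel_measurable borel" "g \<in> borel_measurable borel"
    and H_measurable [measurable]: "H k \<in> borel_measurable borel" for k
    unfolding \<rho>_def g_def H_def by measurable
  have H_nonneg: "0 \<le> H k y" if "ring_at L i j y < \<infinity>" for k y
    using that by (rule ring_at_finite) (auto simp: H_def \<rho>_def hazard_leb_eq hazard_nonneg)

  let ?P = "\<lambda>I. \<Pi>\<^sub>M j\<in>I. exp_clock"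
  define ind where "ind = (\<lambda>k y x. if \<rho> y = 0 then 1 else indicator {H k y..} x :: ennreal)"
  have ind_joint: "(\<lambda>p. ind k (fst p) (snd p)) \<in> borel_measurable (borel \<Otimes>\<^sub>M borel)" for k
  proof -
    have [measurable]: "(\<lambda>p. H k (fst p)) \<in> borel_measurable (borel \<Otimes>\<^sub>M borel)"
      "(\<lambda>p. \<rho> (fst p)) \<in> borel_measurable (borel \<Otimes>\<^sub>M borel)"
      by (auto intro: measurable_compose[OF measurable_fst])
    show ?thesis unfolding ind_def indicator_def atLeast_iff by measurable
  qed
  have ind_clocks [measurable]: "(\<lambda>c. ind k (c j) (c k)) \<in> borel_measurable (?P I)"
    if "j \<in> I" "k \<in> I" for k I
    using that by (intro measurable_compose[OF measurable_Pair ind_joint[of k], simplified])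
      (auto intro: measurable_component_singleton)
  have [measurable]: "ind k y \<in> borel_measurable borel" for k y
    unfolding ind_def by (cases "\<rho> y = 0") auto
  have int_ind: "(\<integral>\<^sup>+x. ind k y x \<partial>exp_clock) = ennreal (exp (- H k y))"
    if "ring_at L i j y < \<infinity>" for k y
  proof (cases "\<rho> y = 0")
    case True
    then show ?thesis using clk.emeasure_space_1 by (simp add: ind_def H_def)
  next
    case False
    then show ?thesis
      using emeasure_exp_clock_atLeast[OF H_nonneg[OF that]] by (simp add: ind_def)
  qed
  have U: "(UNIV :: 'v set) = insert j (UNIV - {j})" by auto

  have "(\<integral>\<^sup>+c. (if rings_first L i c j then f (real_of_ereal (ring_at L i j (c j))) else 0) \<partial>?P UNIV)
      \<le> (\<integral>\<^sup>+c. g (c j) * (\<Prod>k\<in>UNIV - {j}. ind k (c j) (c k)) \<partial>?P UNIV)"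
  proof (rule nn_integral_mono)
    fix c
    show "(if rings_first L i c j then f (real_of_ereal (ring_at L i j (c j))) else 0)
       \<le> g (c j) * (\<Prod>k\<in>UNIV - {j}. ind k (c j) (c k))"
    proof (cases "rings_first L i c j")
      case True
      have "ind k (c j) (c k) = 1" if "k \<noteq> j" for k
        using first_ring_pointwise[OF True that]
        by (cases "\<rho> (c j) = 0") (auto simp: ind_def H_def \<rho>_def)
      then have "(\<Prod>k\<in>UNIV - {j}. ind k (c j) (c k)) = 1"
        by (intro prod.neutral) auto
      with True show ?thesis by (simp add: g_def \<rho>_def rings_first_def)
    qed simp
  qed
  also have "\<dots> = (\<integral>\<^sup>+c. g (c j) * (\<Prod>k\<in>UNIV - {j}. ind k (c j) (c k)) \<partial>?P (insert j (UNIV - {j})))"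
    using U by simp
  also have "\<dots> = (\<integral>\<^sup>+y. \<integral>\<^sup>+c. g y * (\<Prod>k\<in>UNIV - {j}. ind k y (c k)) \<partial>?P (UNIV - {j}) \<partial>exp_clock)"
    by (subst prod.product_nn_integral_insert_rev)
      (auto intro!: nn_integral_cong arg_cong2[where f = "(*)"] prod.cong)
  also have "\<dots> = (\<integral>\<^sup>+y. g y * (\<Prod>k\<in>UNIV - {j}. \<integral>\<^sup>+x. ind k y x \<partial>exp_clock) \<partial>exp_clock)"
  proof (rule nn_integral_cong)
    fix y
    show "(\<integral>\<^sup>+c. g y * (\<Prod>k\<in>UNIV - {j}. ind k y (c k)) \<partial>?P (UNIV - {j})) =
        g y * (\<Prod>k\<in>UNIV - {j}. \<integral>\<^sup>+x. ind k y x \<partial>exp_clock)"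
      by (subst nn_integral_cmult, measurable)
        (subst prod.product_nn_integral_prod, auto)
  qed
  also have "\<dots> = (\<integral>\<^sup>+y. g y * ennreal (exp (- (\<Sum>k\<in>UNIV - {j}. H k y))) \<partial>exp_clock)"
  proof (rule nn_integral_cong)
    fix y
    show "g y * (\<Prod>k\<in>UNIV - {j}. \<integral>\<^sup>+x. ind k y x \<partial>exp_clock) =
      g y * ennreal (exp (- (\<Sum>k\<in>UNIV - {j}. H k y)))"
    proof (cases "ring_at L i j y < \<infinity>")
      case True
      have "(\<Prod>k\<in>UNIV - {j}. \<integral>\<^sup>+x. ind k y x \<partial>exp_clock) = (\<Prod>k\<in>UNIV - {j}. ennreal (exp (- H k y)))"
        by (intro prod.cong refl int_ind True)
      also have "\<dots> = ennreal (exp (- (\<Sum>k\<in>UNIV - {j}. H k y)))"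
        by (subst prod_ennreal) (auto simp: exp_sum sum_negf[symmetric])
      finally show ?thesis by simp
    qed (simp add: g_def)
  qed
  also have "\<dots> = (\<integral>\<^sup>+y. ennreal (exponential_density 1 y) *
      (g y * ennreal (exp (- (\<Sum>k\<in>UNIV - {j}. H k y)))) \<partial>lborel)"
    by (rule nn_integral_density) auto
  also have "\<dots> \<le> B"
  proof -
    define \<phi> where "\<phi> = (\<lambda>y. ennreal (exponential_density 1 y) *
      (g y * ennreal (exp (- (\<Sum>k\<in>UNIV - {j}. H k y)))))"
    have [measurable]: "\<phi> \<in> borel_measurable borel" unfolding \<phi>_def by measurable
    \<comment> \<open>exhaust the stay by intervals \<open>{0..b m}\<close> and use monotone convergence\<close>
    define b where "b = (\<lambda>m. L i * ((real m + 1) / (real m + 2)))"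
    have b: "0 < b m" "b m < L i" for m
    proof -
      show "0 < b m" unfolding b_def using L_pos by (intro mult_pos_pos divide_pos_pos) auto
      have "b m < L i * 1" unfolding b_def using L_pos by (intro mult_strict_left_mono) auto
      then show "b m < L i" by simp
    qed
    have b_mono: "b m \<le> b n" if "m \<le> n" for m n
      unfolding b_def using that L_pos[of i]
      by (intro mult_left_mono) (auto simp: divide_simps, simp add: algebra_simps)
    have b_lim: "b \<longlonglongrightarrow> L i"
    proof -
      have "(\<lambda>m. L i * ((real m + 1) / (real m + 2))) \<longlonglongrightarrow> L i * 1"
        by (intro tendsto_mult tendsto_const) real_asymp
      then show ?thesis by (simp add: b_def)
    qed
    let ?I = "\<lambda>m. indicator {0..hazard L i j (b m)} :: real \<Rightarrow> ennreal"
    have "(\<integral>\<^sup>+y. \<phi> y \<partial>lborel) \<le> (\<integral>\<^sup>+y. (SUP m. \<phi> y * ?I m y) \<partial>lborel)"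
    proof (rule nn_integral_mono)
      fix y
      show "\<phi> y \<le> (SUP m. \<phi> y * ?I m y)"
      proof (cases "0 \<le> y \<and> ring_at L i j y < \<infinity>")
        case True
        then obtain u where u: "0 \<le> u" "u < L i" "y \<le> hazard L i j u"
          unfolding ring_at_finite_iff by blast
        have "\<forall>\<^sub>F m in sequentially. u < b m"
          using order_tendstoD(1)[OF b_lim u(2)] .
        then obtain m where "u < b m" by (auto simp: eventually_sequentially)
        then have "y \<in> {0..hazard L i j (b m)}"
          using u True hazard_mono[of u "b m" j] b[of m] by auto
        then show ?thesis by (intro SUP_upper2[of m]) auto
      next
        case False
        then have "\<phi> y = 0" by (auto simp: \<phi>_def g_def exponential_density_def)
        then show ?thesis by simp
      qed
    qed
    also have "\<dots> = (SUP m. \<integral>\<^sup>+y. \<phi> y * ?I m y \<partial>lborel)"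
    proof (rule nn_integral_monotone_convergence_SUP)
      show "incseq (\<lambda>m y. \<phi> y * ?I m y)"
        using hazard_mono[OF b_mono b(2)]
        by (auto simp: incseq_def le_fun_def split: split_indicator intro: order_trans)
    qed measurable
    also have "\<dots> \<le> B"
    proof (rule SUP_least)
      fix m
      have "(\<integral>\<^sup>+y. \<phi> y * ?I m y \<partial>lborel) =
          (\<integral>\<^sup>+v. \<phi> (hazard L i j v) * ennreal (rate L i j v) * indicator {0..b m} v \<partial>lborel)"
        by (rule clock_substitution[OF _ b]) measurable
      also have "\<dots> = (\<integral>\<^sup>+v. f v * ennreal (exp (- (\<Sum>k\<in>UNIV. hazard L i k v))) * ennreal (rate L i j v)
         * indicator {0..b m} v \<partial>lborel)"
      proof (intro nn_integral_cong)
        fix v :: real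
        show "\<phi> (hazard L i j v) * ennreal (rate L i j v) * indicator {0..b m} v =
          f v * ennreal (exp (- (\<Sum>k\<in>UNIV. hazard L i k v))) * ennreal (rate L i j v) * indicator {0..b m} v"
        proof (cases "v \<in> {0..b m} \<and> {i, j} \<in> E")
          case True
          then have v: "0 \<le> v" "v < L i" "{i, j} \<in> E" using b[of m] by auto
          have H: "H k (hazard L i j v) = hazard L i k v" for k
            unfolding H_def \<rho>_def ring_at_hazard[OF v(3,1,2)]
            using v by (simp add: hazard_leb_eq) (simp add: hazard_def)
          have "(\<Sum>k\<in>UNIV. hazard L i k v) = hazard L i j v + (\<Sum>k\<in>UNIV - {j}. hazard L i k v)"
            by (rule sum.remove) auto
          then have "ennreal (exp (- (\<Sum>k\<in>UNIV. hazard L i k v))) =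
              ennreal (exp (- hazard L i j v)) * ennreal (exp (- (\<Sum>k\<in>UNIV - {j}. hazard L i k v)))"
            by (simp add: ennreal_mult[symmetric] exp_add[symmetric])
          moreover have "g (hazard L i j v) = f v"
            unfolding g_def \<rho>_def ring_at_hazard[OF v(3,1,2)] by simp
          ultimately have "\<phi> (hazard L i j v) = f v * ennreal (exp (- (\<Sum>k\<in>UNIV. hazard L i k v)))"
            unfolding \<phi>_def H using hazard_nonneg[OF v(2), of j]
            by (simp add: exponential_density_def mult_ac)
          then show ?thesis by simp
        qed (auto simp: rate_not_adjacent)
      qed
      also have "\<dots> \<le> B" by (rule bound[OF b])
      finally show "(\<integral>\<^sup>+y. \<phi> y * ?I m y \<partial>lborel) \<le> B" .
    qed
    finally show ?thesis unfolding \<phi>_def .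
  qed
  finally show ?thesis .
qed

end

section \<open>The number of jumps is finite\<close>

context ising_graph
begin

definition spin_sum_bound :: "('v \<Rightarrow> real) \<Rightarrow> real" where
  "spin_sum_bound \<Phi> = (\<Sum>\<sigma>\<in>spins x0. exp (\<Sum>e\<in>E. W e * (\<Prod>x\<in>e. \<Phi> x)))"

definition conductance_bound :: "('v \<Rightarrow> real) \<Rightarrow> real" where
  "conductance_bound \<Phi> = (\<Sum>i\<in>UNIV. \<Sum>j\<in>UNIV. cond i j * \<Phi> j)"

text \<open>The bound \<open>C K\<^sup>n |L|\<^sup>n / (n! M i L)\<close> on the probability of at least \<open>n\<close> jumps. The constants \<open>C\<close> and \<open>K\<close> are taken
  at the initial local times \<open>\<Phi>\<close>, so that they stay the same while \<open>L\<close> decreases.\<close>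

definition jump_bound :: "('v \<Rightarrow> real) \<Rightarrow> nat \<Rightarrow> 'v \<Rightarrow> ('v \<Rightarrow> real) \<Rightarrow> real" where
  "jump_bound \<Phi> n i L =
     spin_sum_bound \<Phi> * conductance_bound \<Phi> ^ n * (\<Sum>x\<in>UNIV. L x) ^ n / (fact n * spin_sum L i)"

lemma spin_sum_bound_nonneg: "0 \<le> spin_sum_bound \<Phi>"
  by (auto simp: spin_sum_bound_def intro!: sum_nonneg)

lemma spin_sum_le_bound:
  assumes "\<And>x. 0 < L x" "\<And>x. L x \<le> \<Phi> x"
  shows "spin_sum L k \<le> spin_sum_bound \<Phi>"
  unfolding spin_sum_def spin_sum_bound_def
proof (rule sum_mono)
  fix \<sigma> assume \<sigma>: "\<sigma> \<in> spins x0"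
  have "W e * (\<Prod>x\<in>e. L x) * (\<Prod>x\<in>e. \<sigma> x) \<le> W e * (\<Prod>x\<in>e. \<Phi> x)" if "e \<in> E" for e
  proof -
    have "W e * (\<Prod>x\<in>e. L x) * (\<Prod>x\<in>e. \<sigma> x) \<le> W e * (\<Prod>x\<in>e. L x)"
      using chi_cases[OF \<sigma>, of e] W_pos[OF that] prod_pos[of e L] assms(1)
      by (auto simp: chi_def)
    also have "\<dots> \<le> W e * (\<Prod>x\<in>e. \<Phi> x)"
      using W_pos[OF that] assms by (intro mult_left_mono prod_mono) (auto intro: less_imp_le)
    finally show ?thesis .
  qed
  then have "ising_weight E (\<lambda>e. W e * (\<Prod>x\<in>e. L x)) \<sigma> \<le> exp (\<Sum>e\<in>E. W e * (\<Prod>x\<in>e. \<Phi> x))"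
    unfolding ising_weight_def by (simp add: sum_mono)
  moreover have "0 < ising_weight E (\<lambda>e. W e * (\<Prod>x\<in>e. L x)) \<sigma>"
    by (rule ising_weight_pos)
  ultimately show "\<sigma> k * ising_weight E (\<lambda>e. W e * (\<Prod>x\<in>e. L x)) \<sigma> \<le> exp (\<Sum>e\<in>E. W e * (\<Prod>x\<in>e. \<Phi> x))"
    using spin_cases[OF \<sigma>, of k] by (auto intro: order_trans[rotated])
qed

lemma conductance_sum_le_bound:
  assumes "\<And>x. 0 < L x" "\<And>x. L x \<le> \<Phi> x"
  shows "(\<Sum>j\<in>UNIV. cond i j * L j) \<le> conductance_bound \<Phi>"
proof -
  have "0 \<le> \<Phi> x" for x using assms[of x] by simp
  then have nn: "0 \<le> cond i j * \<Phi> j" for i j by (simp add: cond_nonneg)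
  have "(\<Sum>j\<in>UNIV. cond i j * L j) \<le> (\<Sum>j\<in>UNIV. cond i j * \<Phi> j)"
    by (intro sum_mono mult_left_mono assms cond_nonneg)
  also have "\<dots> \<le> conductance_bound \<Phi>"
    unfolding conductance_bound_def by (rule member_le_sum) (auto intro: sum_nonneg nn)
  finally show ?thesis .
qed

lemma conductance_bound_nonneg:
  assumes "\<And>x. 0 < L x" "\<And>x. L x \<le> \<Phi> x"
  shows "0 \<le> conductance_bound \<Phi>"
  using conductance_sum_le_bound[OF assms, of undefined] sum_nonneg[of UNIV "\<lambda>j. cond undefined j * L j"]
    assms(1) cond_nonneg by (meson less_imp_le mult_nonneg_nonneg order_trans)

lemma measurable_jump_count_clocks:
  "(\<lambda>\<xi>. jump_count n i L \<xi>) \<in> borel_measurable clocks"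
proof -
  have "sets (clocks :: (nat \<Rightarrow> 'v \<Rightarrow> real) measure) = sets (\<Pi>\<^sub>M n\<in>(UNIV :: nat set). local_times :: ('v \<Rightarrow> real) measure)"
    unfolding clocks_def by (intro sets_PiM_cong) auto
  then have "(\<lambda>\<xi>. (L, \<xi>)) \<in> (clocks :: (nat \<Rightarrow> 'v \<Rightarrow> real) measure) \<rightarrow>\<^sub>M local_times \<Otimes>\<^sub>M (\<Pi>\<^sub>M n\<in>UNIV. local_times)"
    by (intro measurable_Pair measurable_const measurable_ident_sets) (auto simp: space_PiM)
  from measurable_compose[OF this measurable_jump_count] show ?thesis by simp
qed

end

context stay
begin

lemma exp_neg_hazard_sum:
  assumes "0 \<le> v" "v < L i"
  shows "exp (- (\<Sum>k\<in>UNIV. hazard L i k v)) = spin_sum (L(i := L i - v)) i / spin_sum L i"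
  unfolding hazard_sum[OF assms]
  using spin_sum_upd_pos[OF assms(2), of i] spin_sum_positive[OF L_pos]
  by (simp add: exp_diff)

lemma sum_fun_upd: "(\<Sum>x\<in>UNIV. (L(i := L i - v)) x) = (\<Sum>x\<in>UNIV. L x) - v"
  by (simp add: sum.remove[of UNIV i])

lemma measurable_jump_bound:
  "(\<lambda>v. ennreal (jump_bound \<Phi> n j (L(i := L i - v)))) \<in> borel_measurable borel"
proof -
  have "(\<lambda>v. spin_sum (L(i := L i - v)) j) \<in> borel_measurable borel"
    by (intro borel_measurable_continuous_onI continuous_intros)
  then show ?thesis
    unfolding jump_bound_def sum_fun_upd by measurable
qed

lemma measurable_first_ring_jump_bound:
  "(\<lambda>c. if rings_first L i c j
      then ennreal (jump_bound \<Phi> n j (L(i := L i - real_of_ereal (ring_at L i j (c j))))) else 0)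
    \<in> borel_measurable (\<Pi>\<^sub>M j\<in>UNIV. exp_clock)"
proof -
  let ?M = "\<Pi>\<^sub>M j\<in>(UNIV :: 'v set). exp_clock"
  have L[measurable]: "L \<in> space local_times" by (simp add: space_PiM)
  have r: "ring_at L i k \<in> borel_measurable borel" for k
    by (rule measurable_compose[of "\<lambda>y. (L, y)", OF _ measurable_ring_at, simplified]) measurable
  have ring: "(\<lambda>c. ring_at L i k (c k)) \<in> borel_measurable local_times" for k
    by (rule measurable_compose[OF _ r]) measurable
  have sets: "sets ?M = sets local_times" by (intro sets_PiM_cong) auto
  have "(\<lambda>c. real_of_ereal (ring_at L i j (c j))) \<in> borel_measurable local_times"
    by (rule borel_measurable_real_of_ereal[OF ring])
  from measurable_compose[OF this measurable_jump_bound]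
  have 1: "(\<lambda>c. ennreal (jump_bound \<Phi> n j (L(i := L i - real_of_ereal (ring_at L i j (c j))))))
      \<in> borel_measurable ?M"
    using measurable_cong_sets[OF sets refl] by blast
  have [measurable]: "Measurable.pred local_times (\<lambda>c. ring_at L i j (c j) \<le> ring_at L i k (c k))" for k
    unfolding pred_def by (rule borel_measurable_le[OF ring ring])
  have [measurable]: "Measurable.pred local_times (\<lambda>c. ring_at L i j (c j) < \<infinity>)"
    unfolding pred_def by (rule borel_measurable_less[OF ring borel_measurable_const])
  have "Measurable.pred local_times (\<lambda>c. rings_first L i c j)"
    unfolding rings_first_def by measurable
  then have 2: "Measurable.pred ?M (\<lambda>c. rings_first L i c j)"
    using measurable_cong_sets[OF sets refl] by blast
  show ?thesis
    by (rule measurable_If[OF 1 _ 2[unfolded pred_def]]) simp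
qed

text \<open>The induction step of the bound. The spin sums at the time of the jump cancel between the survival
  probability, the rate and the denominator of the bound at the next state; what is left is a
  multiple of \<open>(|L| - v)\<^sup>n\<close>, whose integral provides the factor \<open>|L| / (n + 1)\<close>.\<close>

lemma first_ring_jump_bound:
  assumes L_le: "\<And>x. L x \<le> \<Phi> x"
  shows "(\<integral>\<^sup>+c. (if rings_first L i c j
      then ennreal (jump_bound \<Phi> n j (L(i := L i - real_of_ereal (ring_at L i j (c j))))) else 0)
      \<partial>(\<Pi>\<^sub>M j\<in>UNIV. exp_clock))
    \<le> ennreal (cond i j * L j * (spin_sum_bound \<Phi> * conductance_bound \<Phi> ^ n
        * (\<Sum>x\<in>UNIV. L x) ^ Suc n / (fact (Suc n) * spin_sum L i)))"
    (is "_ \<le> ennreal ?B")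
proof (rule first_ring_integral[where f = "\<lambda>v. ennreal (jump_bound \<Phi> n j (L(i := L i - v)))"])
  define s where "s = (\<Sum>x\<in>UNIV. L x)"
  have s: "(\<Sum>x\<in>UNIV. (L(i := L i - v)) x) = s - v" for v
    unfolding s_def by (rule sum_fun_upd)
  have L_le_s: "L i \<le> s"
    unfolding s_def using L_pos by (intro member_le_sum) (auto intro: less_imp_le)
  show "(\<lambda>v. ennreal (jump_bound \<Phi> n j (L(i := L i - v)))) \<in> borel_measurable borel"
    by (rule measurable_jump_bound)
  fix b assume b: "0 < b" "b < L i"
  define a where "a = cond i j * L j * (spin_sum_bound \<Phi> * conductance_bound \<Phi> ^ n) / (fact n * spin_sum L i)"
  have S: "0 < spin_sum L i" by (rule spin_sum_positive[OF L_pos])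
  have a: "0 \<le> a"
    unfolding a_def using S L_pos[of j] conductance_bound_nonneg[OF L_pos L_le] spin_sum_bound_nonneg[of \<Phi>]
    by (intro divide_nonneg_pos mult_nonneg_nonneg cond_nonneg zero_le_power) auto
  have "(\<integral>\<^sup>+v. ennreal (jump_bound \<Phi> n j (L(i := L i - v))) * ennreal (exp (- (\<Sum>k\<in>UNIV. hazard L i k v)))
         * ennreal (rate L i j v) * indicator {0..b} v \<partial>lborel) =
      (\<integral>\<^sup>+v. ennreal (a * (s - v) ^ n) * indicator {0..b} v \<partial>lborel)"
  proof (intro nn_integral_cong)
    fix v :: real
    show "ennreal (jump_bound \<Phi> n j (L(i := L i - v))) * ennreal (exp (- (\<Sum>k\<in>UNIV. hazard L i k v)))
         * ennreal (rate L i j v) * indicator {0..b} v = ennreal (a * (s - v) ^ n) * indicator {0..b} v"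
    proof (cases "v \<in> {0..b}")
      case True
      then have v: "0 \<le> v" "v < L i" using b by auto
      have P: "0 < spin_sum (L(i := L i - v)) k" for k by (rule spin_sum_upd_pos[OF v(2)])
      have nn: "0 \<le> jump_bound \<Phi> n j (L(i := L i - v))"
        unfolding jump_bound_def s using P[of j] v L_le_s conductance_bound_nonneg[OF L_pos L_le]
          spin_sum_bound_nonneg[of \<Phi>]
        by (intro divide_nonneg_pos mult_nonneg_nonneg zero_le_power) auto
      have "jump_bound \<Phi> n j (L(i := L i - v)) * exp (- (\<Sum>k\<in>UNIV. hazard L i k v)) * rate L i j v
          = a * (s - v) ^ n"
        unfolding jump_bound_def s exp_neg_hazard_sum[OF v] rate_eq a_def
        using P[of j] P[of i] S by (simp add: field_simps)
      then show ?thesis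
        using True nn by (simp add: ennreal_mult[symmetric] rate_nonneg v)
    qed simp
  qed
  also have "\<dots> = ennreal (- a * (s - b) ^ Suc n / (real n + 1) - (- a * (s - 0) ^ Suc n / (real n + 1)))"
  proof (rule nn_integral_FTC_Icc[where F = "\<lambda>v. - a * (s - v) ^ Suc n / (real n + 1)"])
    fix v assume v: "v \<in> {0..b}"
    then show "0 \<le> a * (s - v) ^ n" using a b L_le_s by simp
    have "((\<lambda>v. - a * (s - v) ^ Suc n / (real n + 1)) has_real_derivative
        - a * (real (Suc n) * (s - v) ^ n * (- 1)) / (real n + 1)) (at v)"
      by (rule derivative_eq_intros refl | simp)+
    also have "- a * (real (Suc n) * (s - v) ^ n * (- 1)) / (real n + 1) = a * (s - v) ^ n"
      by (simp add: add.commute)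
    finally show "((\<lambda>v. - a * (s - v) ^ Suc n / (real n + 1)) has_real_derivative a * (s - v) ^ n) (at v)" .
  qed (use b in auto)
  also have "\<dots> \<le> ennreal (a * s ^ Suc n / (real n + 1))"
  proof (rule ennreal_leI)
    have "0 \<le> a * (s - b) ^ Suc n / (real n + 1)"
      using a b L_le_s by (intro divide_nonneg_nonneg mult_nonneg_nonneg zero_le_power) auto
    then show "- a * (s - b) ^ Suc n / (real n + 1) - (- a * (s - 0) ^ Suc n / (real n + 1))
        \<le> a * s ^ Suc n / (real n + 1)"
      by (simp del: power_Suc)
  qed
  also have "a * s ^ Suc n / (real n + 1) = ?B"
    unfolding a_def s_def[symmetric] by (simp add: field_simps)
  finally show "(\<integral>\<^sup>+v. ennreal (jump_bound \<Phi> n j (L(i := L i - v))) *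
      ennreal (exp (- (\<Sum>k\<in>UNIV. hazard L i k v))) * ennreal (rate L i j v) * indicator {0..b} v \<partial>lborel)
      \<le> ennreal ?B" .
qed

end

context ising_graph
begin

text \<open>By induction on \<open>n\<close>: the clocks form the product of the first family and an independent copy
  of the whole sequence, so the induction hypothesis applies to the state after the first jump.\<close>

lemma jump_count_integral_le:
  assumes "\<And>x. 0 < L x" "\<And>x. L x \<le> \<Phi> x"
  shows "(\<integral>\<^sup>+\<xi>. jump_count n i L \<xi> \<partial>clocks) \<le> ennreal (jump_bound \<Phi> n i L)"
  using assms
proof (induction n arbitrary: i L)
  case 0
  interpret clk: prob_space exp_clock by (rule prob_space_exp_clock)
  interpret clks: prob_space "clocks :: (nat \<Rightarrow> 'v \<Rightarrow> real) measure"
    unfolding clocks_def by (intro prob_space_PiM clk.prob_space_axioms)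
  have "1 \<le> jump_bound \<Phi> 0 i L"
    using spin_sum_positive[of L i, OF 0(1)] spin_sum_le_bound[of L \<Phi> i, OF 0]
    by (simp add: jump_bound_def)
  then have "1 \<le> ennreal (jump_bound \<Phi> 0 i L)"
    by (metis ennreal_1 ennreal_leI)
  then show ?case
    by (simp add: clks.emeasure_space_1)
next
  case (Suc n)
  interpret stay E W x0 L i
    by unfold_locales (rule Suc.prems)
  interpret clk: prob_space exp_clock by (rule prob_space_exp_clock)
  let ?S = "\<Pi>\<^sub>M j\<in>(UNIV :: 'v set). exp_clock"
  interpret S: prob_space ?S by (intro prob_space_PiM clk.prob_space_axioms)
  interpret Q: sequence_space ?S by unfold_locales
  have clocks: "clocks = (\<Pi>\<^sub>M n\<in>(UNIV :: nat set). ?S)" by (simp add: clocks_def)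
  interpret clks: prob_space "clocks :: (nat \<Rightarrow> 'v \<Rightarrow> real) measure"
    unfolding clocks by (intro prob_space_PiM S.prob_space_axioms)
  define R where "R = spin_sum_bound \<Phi> * conductance_bound \<Phi> ^ n
        * (\<Sum>x\<in>UNIV. L x) ^ Suc n / (fact (Suc n) * spin_sum L i)"
  have R: "0 \<le> R"
    unfolding R_def
    using spin_sum_positive[OF L_pos] conductance_bound_nonneg[OF Suc.prems] spin_sum_bound_nonneg[of \<Phi>]
    by (intro divide_nonneg_pos mult_nonneg_nonneg zero_le_power sum_nonneg less_imp_le[OF L_pos]) auto
  let ?next = "\<lambda>c j. L(i := L i - real_of_ereal (ring_at L i j (c j)))"
  have cons: "(\<lambda>(c, \<omega>). case_nat c \<omega>) \<in> ?S \<Otimes>\<^sub>M clocks \<rightarrow>\<^sub>M clocks"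
    unfolding clocks by measurable
  have "(\<integral>\<^sup>+\<xi>. jump_count (Suc n) i L \<xi> \<partial>clocks) =
      (\<integral>\<^sup>+\<xi>. jump_count (Suc n) i L \<xi> \<partial>distr (?S \<Otimes>\<^sub>M clocks) clocks (\<lambda>(c, \<omega>). case_nat c \<omega>))"
    unfolding clocks Q.PiM_iter ..
  also have "\<dots> = (\<integral>\<^sup>+x. jump_count (Suc n) i L (case_nat (fst x) (snd x)) \<partial>(?S \<Otimes>\<^sub>M clocks))"
    by (subst nn_integral_distr[OF cons])
      (simp_all add: case_prod_beta' measurable_jump_count_clocks del: jump_count.simps)
  also have "\<dots> = (\<integral>\<^sup>+c. \<integral>\<^sup>+\<omega>. jump_count (Suc n) i L (case_nat c \<omega>) \<partial>clocks \<partial>?S)"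
    using measurable_compose[OF cons measurable_jump_count_clocks]
    by (subst clks.nn_integral_fst[symmetric]) (simp_all add: case_prod_beta' del: jump_count.simps)
  also have "\<dots> = (\<integral>\<^sup>+c. (\<Sum>j\<in>UNIV. if rings_first L i c j
      then (\<integral>\<^sup>+\<omega>. jump_count n j (?next c j) \<omega> \<partial>clocks) else 0) \<partial>?S)"
  proof (rule nn_integral_cong)
    fix c
    have "(\<integral>\<^sup>+\<omega>. jump_count (Suc n) i L (case_nat c \<omega>) \<partial>clocks) =
      (\<Sum>j\<in>UNIV. \<integral>\<^sup>+\<omega>. (if rings_first L i c j then jump_count n j (?next c j) \<omega> else 0) \<partial>clocks)"
      unfolding jump_count.simps nat.case
    proof (rule nn_integral_sum)
      fix j
      show "(\<lambda>\<omega>. if rings_first L i c j then jump_count n j (?next c j) \<omega> else 0)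
          \<in> borel_measurable clocks"
        by (cases "rings_first L i c j") (simp_all add: measurable_jump_count_clocks)
    qed
    also have "\<dots> = (\<Sum>j\<in>UNIV. if rings_first L i c j
        then (\<integral>\<^sup>+\<omega>. jump_count n j (?next c j) \<omega> \<partial>clocks) else 0)"
      by (intro sum.cong) auto
    finally show "(\<integral>\<^sup>+\<omega>. jump_count (Suc n) i L (case_nat c \<omega>) \<partial>clocks) = \<dots>" .
  qed
  also have "\<dots> \<le> (\<integral>\<^sup>+c. (\<Sum>j\<in>UNIV. if rings_first L i c j
      then ennreal (jump_bound \<Phi> n j (?next c j)) else 0) \<partial>?S)"
  proof (intro nn_integral_mono sum_mono)
    fix c j
    show "(if rings_first L i c j then (\<integral>\<^sup>+\<omega>. jump_count n j (?next c j) \<omega> \<partial>clocks) else 0)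
       \<le> (if rings_first L i c j then ennreal (jump_bound \<Phi> n j (?next c j)) else 0)"
    proof (cases "rings_first L i c j")
      case True
      then obtain v where v: "ring_at L i j (c j) = ereal v" "0 \<le> v" "v < L i"
        unfolding rings_first_def by (elim conjE ring_at_finite)
      have "(\<integral>\<^sup>+\<omega>. jump_count n j (?next c j) \<omega> \<partial>clocks) \<le> ennreal (jump_bound \<Phi> n j (?next c j))"
      proof (rule Suc.IH)
        fix x
        show "0 < (?next c j) x" using v L_upd_pos[of v x] by simp
        show "(?next c j) x \<le> \<Phi> x" using v Suc.prems(2)[of x] by auto
      qed
      then show ?thesis using True by simp
    qed simp
  qed
  also have "\<dots> = (\<Sum>j\<in>UNIV. \<integral>\<^sup>+c. (if rings_first L i c j
      then ennreal (jump_bound \<Phi> n j (?next c j)) else 0) \<partial>?S)"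
    by (rule nn_integral_sum) (rule measurable_first_ring_jump_bound)
  also have "\<dots> \<le> (\<Sum>j\<in>UNIV. ennreal (cond i j * L j * R))"
    unfolding R_def by (intro sum_mono first_ring_jump_bound Suc.prems)
  also have "\<dots> = ennreal ((\<Sum>j\<in>UNIV. cond i j * L j) * R)"
    unfolding sum_distrib_right
    by (intro sum_ennreal mult_nonneg_nonneg cond_nonneg less_imp_le[OF L_pos] R)
  also have "\<dots> \<le> ennreal (conductance_bound \<Phi> * R)"
    by (intro ennreal_leI mult_right_mono conductance_sum_le_bound Suc.prems R)
  also have "conductance_bound \<Phi> * R = jump_bound \<Phi> (Suc n) i L"
    by (simp add: R_def jump_bound_def mult_ac)
  finally show ?case .
qed

text \<open>Markov's inequality. The bounds tend to 0 because, up to a constant factor, they are the terms of an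
  exponential series.\<close>

lemma AE_jump_count_less_1:
  assumes "\<And>x. 0 < \<Phi> x"
  shows "AE \<xi> in clocks. \<exists>n. jump_count n i \<Phi> \<xi> < 1"
proof -
  let ?N = "{\<xi> \<in> space (clocks :: (nat \<Rightarrow> 'v \<Rightarrow> real) measure). \<forall>n. 1 \<le> jump_count n i \<Phi> \<xi>}"
  note [measurable] = measurable_jump_count_clocks
  have N: "?N \<in> sets clocks" by measurable
  have "emeasure clocks ?N \<le> ennreal (jump_bound \<Phi> n i \<Phi>)" for n
  proof -
    have "emeasure clocks ?N = (\<integral>\<^sup>+\<xi>. indicator ?N \<xi> \<partial>clocks)" using N by simp
    also have "\<dots> \<le> (\<integral>\<^sup>+\<xi>. jump_count n i \<Phi> \<xi> \<partial>clocks)"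
      by (intro nn_integral_mono) (auto simp: indicator_def)
    also have "\<dots> \<le> ennreal (jump_bound \<Phi> n i \<Phi>)"
      by (intro jump_count_integral_le assms order_refl)
    finally show ?thesis .
  qed
  moreover have "(\<lambda>n. ennreal (jump_bound \<Phi> n i \<Phi>)) \<longlonglongrightarrow> ennreal 0"
  proof (rule tendsto_ennrealI)
    let ?x = "conductance_bound \<Phi> * (\<Sum>x\<in>UNIV. \<Phi> x)"
    have "(\<lambda>n. inverse (fact n) * ?x ^ n) \<longlonglongrightarrow> 0"
      by (rule summable_LIMSEQ_zero[OF summable_exp])
    then have "(\<lambda>n. spin_sum_bound \<Phi> / spin_sum \<Phi> i * (inverse (fact n) * ?x ^ n))
        \<longlonglongrightarrow> spin_sum_bound \<Phi> / spin_sum \<Phi> i * 0"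
      by (intro tendsto_mult tendsto_const)
    then show "(\<lambda>n. jump_bound \<Phi> n i \<Phi>) \<longlonglongrightarrow> 0"
      by (simp add: jump_bound_def power_mult_distrib field_simps)
  qed
  ultimately have "emeasure clocks ?N \<le> ennreal 0"
    by (intro LIMSEQ_le_const[of _ "ennreal 0"]) auto
  then have "emeasure clocks ?N = 0" by simp
  then show ?thesis
    using N by (intro AE_I[of _ _ ?N]) (auto simp: not_less)
qed

end

section \<open>The path and its end\<close>

context ising_graph
begin

text \<open>The jump chain from an arbitrary state, which can be decomposed at the first jump.\<close>

primrec run :: "ereal \<times> 'v \<times> ('v \<Rightarrow> real) \<Rightarrow> (nat \<Rightarrow> 'v \<Rightarrow> real) \<Rightarrow> nat \<Rightarrow>
    ereal \<times> 'v \<times> ('v \<Rightarrow> real)" where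
  "run s \<xi> 0 = s"
| "run s \<xi> (Suc n) = next_jump E W x0 (\<xi> n) (run s \<xi> n)"

lemma run_shift: "run s \<xi> (Suc n) = run (next_jump E W x0 (\<xi> 0) s) (\<lambda>m. \<xi> (Suc m)) n"
  by (induction n) simp_all

lemma jump_chain_eq_run: "jump_chain E W x0 \<Phi> z \<xi> n = run (0, z, \<Phi>) \<xi> n"
  by (induction n) simp_all

lemma next_jump_infinite: "fst (next_jump E W x0 c (\<infinity>, i, L)) = \<infinity>"
  by (simp add: next_jump_def Let_def)

lemma run_infinite: "fst s = \<infinity> \<Longrightarrow> fst (run s \<xi> n) = \<infinity>"
  by (induction n) (simp_all, metis next_jump_infinite prod.collapse)

end

context stay
begin

text \<open>Away from \<open>x0\<close> some clock always rings. A clock that rings first attains the infimum in the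
  definition of the chain, since there are finitely many clocks.\<close>

lemma next_jump_cases:
  obtains
    (stop) "i = x0" "next_jump E W x0 c (t, i, L) = (\<infinity>, i, L)"
  | (jump) j v where "rings_first L i c j" "ring_at L i j (c j) = ereal v" "0 \<le> v" "v < L i"
      "next_jump E W x0 c (t, i, L) = (t + ereal v, j, L(i := L i - v))"
proof -
  define \<tau> where "\<tau> = (INF j. ring_time E W x0 L i c j)"
  define j where "j = arg_min_on (ring_time E W x0 L i c) UNIV"
  have min: "ring_time E W x0 L i c j \<le> ring_time E W x0 L i c k" for k
    unfolding j_def by (rule arg_min_least) auto
  then have \<tau>: "\<tau> = ring_time E W x0 L i c j"
    unfolding \<tau>_def by (intro antisym INF_lower INF_greatest) auto
  show ?thesis
  proof (cases "\<tau> = \<infinity>")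
    case True
    then have "\<not> ring_time E W x0 L i c k < \<infinity>" for k
      using min[of k] \<tau> by (metis ereal_infty_less_eq(1) less_irrefl)
    then have "i = x0" using some_clock_rings by blast
    then show ?thesis using True by (intro stop) (auto simp: next_jump_def \<tau>_def)
  next
    case False
    then have "ring_at L i j (c j) < \<infinity>" by (simp add: \<tau> ring_time_eq_ring_at)
    then obtain v where v: "ring_at L i j (c j) = ereal v" "0 \<le> v" "v < L i"
      by (rule ring_at_finite)
    moreover have "rings_first L i c j"
      using min v(1) by (auto simp: rings_first_def ring_time_eq_ring_at)
    moreover have "\<tau> = ereal v" using v by (simp add: \<tau> ring_time_eq_ring_at)
    then have "next_jump E W x0 c (t, i, L) = (t + ereal v, j, L(i := L i - v))"
      unfolding next_jump_def prod.case \<tau>_def[symmetric] j_def[symmetric] by simp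
    ultimately show ?thesis by (intro jump)
  qed
qed

end

context ising_graph
begin

lemma run_finite_imp_jump_count:
  assumes "\<And>x. 0 < L x" "fst (run (t, i, L) \<xi> n) < \<infinity>"
  shows "1 \<le> jump_count n i L \<xi>"
  using assms
proof (induction n arbitrary: t i L \<xi>)
  case 0
  then show ?case by simp
next
  case (Suc n)
  interpret stay E W x0 L i by unfold_locales (rule Suc.prems)
  show ?case
  proof (cases rule: next_jump_cases[of "\<xi> 0" t])
    case stop
    then show ?thesis
      using Suc.prems(2) run_infinite[of "(\<infinity>, i, L)"] unfolding run_shift by simp
  next
    case (jump j v)
    have "1 \<le> jump_count n j (L(i := L i - v)) (\<lambda>m. \<xi> (Suc m))"
    proof (rule Suc.IH)
      show "fst (run (t + ereal v, j, L(i := L i - v)) (\<lambda>m. \<xi> (Suc m)) n) < \<infinity>"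
        using Suc.prems(2) unfolding run_shift jump(5) .
    qed (rule L_upd_pos[OF jump(4)])
    also have "\<dots> = (if rings_first L i (\<xi> 0) j
       then jump_count n j (L(i := L i - real_of_ereal (ring_at L i j (\<xi> 0 j)))) (\<lambda>m. \<xi> (Suc m))
       else 0)"
      using jump by simp
    also have "\<dots> \<le> jump_count (Suc n) i L \<xi>"
      unfolding jump_count.simps by (rule member_le_sum) auto
    finally show ?thesis .
  qed
qed

text \<open>Up to the first infinite jump time all states have finite times and positive local times, and
  the vertex at which the chain stops is \<open>x0\<close>.\<close>

lemma run_path:
  assumes "\<And>x. 0 < L x" "fst (run (ereal 0, z, L) \<xi> N) = \<infinity>"
  obtains n t i M where
    "\<And>m. m \<le> n \<Longrightarrow> run (ereal 0, z, L) \<xi> m = (ereal (t m), i m, M m)"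
    "fst (run (ereal 0, z, L) \<xi> (Suc n)) = \<infinity>" "i n = x0" "t 0 = 0" "M 0 = L"
    "\<And>m x. m \<le> n \<Longrightarrow> 0 < M m x"
    "\<And>m. m < n \<Longrightarrow> t m \<le> t (Suc m) \<and> M (Suc m) = (M m)(i m := M m (i m) - (t (Suc m) - t m))"
proof -
  let ?r = "run (ereal 0, z, L) \<xi>"
  define n where "n = (LEAST n. fst (?r (Suc n)) = \<infinity>)"
  have "N \<noteq> 0" using assms(2) by (cases N) auto
  then obtain N' where "N = Suc N'" by (cases N) auto
  then have inf: "fst (?r (Suc n)) = \<infinity>"
    unfolding n_def using assms(2) by (intro LeastI) auto
  have fin: "fst (?r (Suc m)) \<noteq> \<infinity>" if "m < n" for m
    using not_less_Least that unfolding n_def by blast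
  define t where "t m = real_of_ereal (fst (?r m))" for m
  define i where "i m = fst (snd (?r m))" for m
  define M where "M m = snd (snd (?r m))" for m
  have state: "?r m = (ereal (t m), i m, M m) \<and> (\<forall>x. 0 < M m x)" if "m \<le> n" for m
    using that
  proof (induction m)
    case 0
    then show ?case using assms(1) by (simp add: t_def i_def M_def)
  next
    case (Suc m)
    then have IH: "?r m = (ereal (t m), i m, M m)" "\<And>x. 0 < M m x" by auto
    interpret stay E W x0 "M m" "i m" by unfold_locales (rule IH)
    show ?case
    proof (cases rule: next_jump_cases[of "\<xi> m" "ereal (t m)"])
      case stop
      then show ?thesis using fin[of m] Suc.prems IH(1) by simp
    next
      case (jump j v)
      then have "?r (Suc m) = (ereal (t m + v), j, (M m)(i m := M m (i m) - v))"
        using IH(1) by simp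
      then show ?thesis
        using L_upd_pos[OF jump(4)]
        by (simp add: t_def[of "Suc m"] i_def[of "Suc m"] M_def[of "Suc m"] fun_upd_def del: run.simps)
    qed
  qed
  have step: "t m \<le> t (Suc m) \<and> M (Suc m) = (M m)(i m := M m (i m) - (t (Suc m) - t m))" if "m < n" for m
  proof -
    have st: "?r m = (ereal (t m), i m, M m)" "\<And>x. 0 < M m x" using state[of m] that by auto
    interpret stay E W x0 "M m" "i m" by unfold_locales (rule st)
    show ?thesis
    proof (cases rule: next_jump_cases[of "\<xi> m" "ereal (t m)"])
      case stop
      then show ?thesis using fin[of m] that st(1) by simp
    next
      case (jump j v)
      then have "?r (Suc m) = (ereal (t m + v), j, (M m)(i m := M m (i m) - v))"
        using st(1) by simp
      moreover have "?r (Suc m) = (ereal (t (Suc m)), i (Suc m), M (Suc m))"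
        using state[of "Suc m"] that by simp
      ultimately have "t (Suc m) = t m + v" "M (Suc m) = (M m)(i m := M m (i m) - v)"
        by (simp_all only: prod.inject ereal.inject)
      then show ?thesis using jump(3) by simp
    qed
  qed
  have last: "i n = x0"
  proof -
    have st: "?r n = (ereal (t n), i n, M n)" "\<And>x. 0 < M n x" using state[of n] by auto
    interpret stay E W x0 "M n" "i n" by unfold_locales (rule st)
    show ?thesis
      by (cases rule: next_jump_cases[of "\<xi> n" "ereal (t n)"]) (use inf st(1) in auto)
  qed
  show ?thesis
    by (rule that[of n t i M]) (use state step last inf in \<open>auto simp: t_def M_def\<close>)
qed

end

text \<open>The quantities \<open>M m\<close> are the remaining local times at the jump times. During the last stay only the
  local time of \<open>i n\<close> decreases, so it is the first to reach 0, at time \<open>t n + M n (i n)\<close>.\<close>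

lemma piecewise_constant_end:
  fixes t :: "nat \<Rightarrow> real" and i :: "nat \<Rightarrow> 'v" and M :: "nat \<Rightarrow> 'v \<Rightarrow> real"
  assumes t0: "t 0 = 0" and t_mono: "\<And>m. m < n \<Longrightarrow> t m \<le> t (Suc m)"
    and y_step: "\<And>m s. m < n \<Longrightarrow> t m \<le> s \<Longrightarrow> s < t (Suc m) \<Longrightarrow> y s = Some (i m)"
    and y_last: "\<And>s. t n \<le> s \<Longrightarrow> y s = Some (i n)"
    and M0: "M 0 = \<Phi>"
    and M_Suc: "\<And>m. m < n \<Longrightarrow> M (Suc m) = (M m)(i m := M m (i m) - (t (Suc m) - t m))"
    and M_pos: "\<And>x. 0 < M n x"
  shows "stop_time \<Phi> y = ereal (t n + M n (i n))"
    and "ends_at y (ereal (t n + M n (i n))) (i n)"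
proof -
  define f where "f x r = (if y r = Some x then 1 else 0 :: real)" for x r
  have t_nonneg: "m \<le> n \<Longrightarrow> 0 \<le> t m" for m
    by (induction m) (use t0 t_mono in \<open>auto intro: order_trans\<close>)
  have const: "(f x has_integral (if x = i m then b - a else 0)) {a..b}"
    if "a \<le> b" "\<And>s. a \<le> s \<Longrightarrow> s < b \<Longrightarrow> y s = Some (i m)" for a b m x
  proof (rule has_integral_spike_finite)
    show "((\<lambda>_. if x = i m then 1 else 0 :: real) has_integral (if x = i m then b - a else 0)) {a..b}"
      using has_integral_const_real[of "if x = i m then 1 else 0 :: real" a b] that(1) by auto
    show "finite {b}" by simp
    show "f x s = (if x = i m then 1 else 0)" if "s \<in> {a..b} - {b}" for s
      using that \<open>\<And>s. a \<le> s \<Longrightarrow> s < b \<Longrightarrow> y s = Some (i m)\<close>[of s] by (auto simp: f_def)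
  qed
  have int_f: "(f x has_integral (\<Phi> x - M m x)) {0..t m}" if "m \<le> n" for m x
    using that
  proof (induction m)
    case 0
    then show ?case by (simp add: t0 M0 has_integral_refl)
  next
    case (Suc m)
    have "(f x has_integral ((\<Phi> x - M m x) + (if x = i m then t (Suc m) - t m else 0))) {0..t (Suc m)}"
      using Suc t_nonneg[of m] t_mono[of m]
      by (intro has_integral_combine[OF _ _ _ const]) (auto intro: y_step)
    then show ?case using Suc M_Suc[of m] by (simp add: algebra_simps split: if_splits)
  qed
  have int_last: "(f x has_integral ((\<Phi> x - M n x) + (if x = i n then s - t n else 0))) {0..s}"
    if "t n \<le> s" for x s
    using that t_nonneg[of n]
    by (intro has_integral_combine[OF _ _ int_f[OF order_refl] const]) (auto intro: y_last)
  have rem: "remaining_time \<Phi> y x s = \<Phi> x - integral {0..s} (f x)" for x s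
    by (simp add: remaining_time_def f_def[abs_def])
  have late: "remaining_time \<Phi> y x s = M n x - (if x = i n then s - t n else 0)" if "t n \<le> s" for x s
    using integral_unique[OF int_last[OF that, of x]] unfolding rem by simp
  have early: "0 < remaining_time \<Phi> y x s" if "0 \<le> s" "s < t n" for x s
  proof -
    have i: "f x integrable_on {0..t n}" using int_f[of n x] by blast
    have "f x integrable_on {0..s}"
      by (rule integrable_on_subinterval[OF i]) (use that in auto)
    then have "integral {0..s} (f x) \<le> integral {0..t n} (f x)"
      using that by (intro integral_subset_le i) (auto simp: f_def)
    also have "\<dots> = \<Phi> x - M n x" by (rule integral_unique[OF int_f[OF order_refl]])
    finally show ?thesis using M_pos[of x] unfolding rem by simp
  qed
  define T where "T = t n + M n (i n)"
  have T: "t n < T" using M_pos by (simp add: T_def)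
  have alive: "(\<forall>x. 0 < remaining_time \<Phi> y x s) \<longleftrightarrow> s < T" if "0 \<le> s" for s
  proof (cases "s < t n")
    case True
    then show ?thesis using early[OF that True] T by auto
  next
    case False
    then have "remaining_time \<Phi> y x s = M n x - (if x = i n then s - t n else 0)" for x
      by (intro late) simp
    then show ?thesis using M_pos unfolding T_def by (auto dest: spec[of _ "i n"])
  qed
  have "stop_time \<Phi> y = Sup {ereal s | s. 0 \<le> s \<and> s < T}"
    unfolding stop_time_def using alive by (intro arg_cong[where f = Sup]) auto
  also have "\<dots> = ereal T"
  proof (rule Sup_eqI)
    fix u assume u: "\<And>w. w \<in> {ereal s | s. 0 \<le> s \<and> s < T} \<Longrightarrow> w \<le> u"
    show "ereal T \<le> u"
    proof (rule dense_le_bounded[of "ereal 0"])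
      show "ereal 0 < ereal T" using T t_nonneg[of n] by simp
      fix w assume "ereal 0 < w" "w < ereal T"
      then show "w \<le> u" by (intro u) (cases w, auto)
    qed
  qed auto
  finally show "stop_time \<Phi> y = ereal (t n + M n (i n))" unfolding T_def .
  show "ends_at y (ereal (t n + M n (i n))) (i n)"
    unfolding ends_at_def eventually_at_left_field T_def[symmetric]
    using T by (intro exI[of _ "t n"]) (auto intro: y_last)
qed

context ising_graph
begin

text \<open>Here no randomness is left: any clocks for which the jumps come to an end give a path that ends at \<open>x0\<close>.\<close>

lemma finitely_many_jumps_end:
  assumes "\<And>x. 0 < \<Phi> x" "jump_time E W x0 \<Phi> z \<xi> N = \<infinity>"
  shows "stop_time \<Phi> (Y_path E W x0 \<Phi> z \<xi>) < \<infinity> \<and>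
    ends_at (Y_path E W x0 \<Phi> z \<xi>) (stop_time \<Phi> (Y_path E W x0 \<Phi> z \<xi>)) x0"
proof -
  have "fst (run (ereal 0, z, \<Phi>) \<xi> N) = \<infinity>"
    using assms(2) by (simp add: jump_time_def jump_chain_eq_run zero_ereal_def)
  from run_path[OF assms(1) this] obtain n t i M where
    state: "\<And>m. m \<le> n \<Longrightarrow> run (ereal 0, z, \<Phi>) \<xi> m = (ereal (t m), i m, M m)"
    and inf: "fst (run (ereal 0, z, \<Phi>) \<xi> (Suc n)) = \<infinity>" and last: "i n = x0"
    and t0: "t 0 = 0" and M0: "M 0 = \<Phi>" and M_pos: "\<And>m x. m \<le> n \<Longrightarrow> 0 < M m x"
    and step: "\<And>m. m < n \<Longrightarrow> t m \<le> t (Suc m) \<and> M (Suc m) = (M m)(i m := M m (i m) - (t (Suc m) - t m))"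
    by blast
  let ?T = "jump_time E W x0 \<Phi> z \<xi>" and ?y = "Y_path E W x0 \<Phi> z \<xi>"
  have T: "?T m = ereal (t m)" "jump_vertex E W x0 \<Phi> z \<xi> m = i m" if "m \<le> n" for m
    using state[OF that] by (simp_all add: jump_time_def jump_vertex_def jump_chain_eq_run zero_ereal_def)
  have T_inf: "?T (Suc n) = \<infinity>"
    using inf by (simp add: jump_time_def jump_chain_eq_run zero_ereal_def)
  have t_mono: "t k \<le> t m" if "k \<le> m" "m \<le> n" for k m
    using that by (induction m rule: dec_induct) (use step in \<open>auto intro: order_trans\<close>)
  have y: "?y s = Some (i m)" if "m \<le> n" "t m \<le> s" "ereal s < ?T (Suc m)" for m s
  proof -
    have "(LEAST k. ereal s < ?T (Suc k)) = m"
    proof (rule Least_equality)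
      fix k assume k: "ereal s < ?T (Suc k)"
      show "m \<le> k"
      proof (rule ccontr)
        assume "\<not> m \<le> k"
        then have "t (Suc k) \<le> t m" "?T (Suc k) = ereal (t (Suc k))"
          using that(1) t_mono[of "Suc k" m] T(1)[of "Suc k"] by auto
        then show False using k that(2) by simp
      qed
    qed (rule that(3))
    then show ?thesis using that T(2)[OF that(1)] by (auto simp: Y_path_def)
  qed
  have y_step: "?y s = Some (i m)" if "m < n" "t m \<le> s" "s < t (Suc m)" for m s
    using that T(1)[of "Suc m"] by (intro y) auto
  have y_last: "?y s = Some (i n)" if "t n \<le> s" for s
    using that T_inf by (intro y) auto
  note piecewise_constant_end[OF t0 conjunct1[OF step] y_step y_last M0 conjunct2[OF step] M_pos[OF order_refl]]
  then show ?thesis by (simp add: last)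
qed

end

theorem lemma1:
  fixes E :: "'v::finite set set"
    and W :: "'v set \<Rightarrow> real"
    and x0 z :: 'v
    and \<Phi> :: "'v \<Rightarrow> real"
  assumes "loopless E"
    and "connected_graph E"
    and "\<And>e. e \<in> E \<Longrightarrow> W e > 0"
    and "\<And>x. \<Phi> x > 0"
  shows "AE \<xi> in clocks.
           stop_time \<Phi> (Y_path E W x0 \<Phi> z \<xi>) < \<infinity> \<and>
           ends_at (Y_path E W x0 \<Phi> z \<xi>) (stop_time \<Phi> (Y_path E W x0 \<Phi> z \<xi>)) x0"
proof -
  interpret ising_graph E W x0 by unfold_locales (fact assms)+
  show ?thesis
    using AE_jump_count_less_1[of \<Phi> z, OF assms(4)]
  proof eventually_elim
    case (elim \<xi>)
    then obtain n where "jump_count n z \<Phi> \<xi> < 1" by blast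
    then have "\<not> fst (run (0, z, \<Phi>) \<xi> n) < \<infinity>"
      using run_finite_imp_jump_count[of \<Phi> 0 z \<xi> n] assms(4) by (meson not_le)
    then have "jump_time E W x0 \<Phi> z \<xi> n = \<infinity>"
      by (simp add: jump_time_def jump_chain_eq_run)
    from finitely_many_jumps_end[OF assms(4) this] show ?case .
  qed
qed

end
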